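(* Each word $w\in\mathbf W$ is $\mathfrak{gl}_{\mathcal N}$-equivalent to a unique quasi-ribbon tableau.
   Context: $\mathcal N=\frac12\mathbb Z_{>0}$ with its usual linear order; elements of $\mathbb Z_{>0}$ are even, elements of $\frac12+\mathbb Z_{\ge0}$ are odd. $I=\frac12\mathbb Z_{>0}$. $P=\bigoplus_{b\in\mathcal N}\mathbb Z\epsilon_b$ with $(\epsilon_a,\epsilon_b)=(-1)^{|a|}\delta_{ab}$ ($|a|$ the parity). Simple roots: $\alpha_i=\epsilon_i-\epsilon_{i+\frac12}$, $i\in I$. A $\mathfrak{gl}_{\mathcal N}$-crystal is a set $B$ with maps $\mathrm{wt}:B\to P$, $\varepsilon_i,\varphi_i:B\to\mathbb Z_{\ge0}$, $e_i,f_i:B\to B\cup\{\mathbf 0\}$ ($i\in I$; $\mathbf 0$ a formal symbol) such that: (1) $\varphi_i(b)+\varepsilon_i(b)$ is $1$ if $(\mathrm{wt}(b),\alpha_i)\ne0$ and $0$ otherwise; (2) if $e_ib\in B$ then $\varepsilon_i(e_ib)=\varepsilon_i(b)-1$, $\varphi_i(e_ib)=\varphi_i(b)+1$, $\mathrm{wt}(e_ib)=\mathrm{wt}(b)+\alpha_i$; (3) if $f_ib\in B$ then $\varepsilon_i(f_ib)=\varepsilon_i(b)+1$, $\varphi_i(f_ib)=\varphi_i(b)-1$, $\mathrm{wt}(f_ib)=\mathrm{wt}(b)-\alpha_i$; (4) $f_ib=b'$ iff $b=e_ib'$. It is viewed as an $I$-colored oriented graph ($b\xrightarrow{i}b'$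 iff $b'=f_ib$). An isomorphism of crystals is an isomorphism of colored oriented graphs preserving $\mathrm{wt},\varepsilon_i,\varphi_i$. $C(b)$ is the connected component of $b$. $b_1\in B_1$ and $b_2\in B_2$ are $\mathfrak{gl}_{\mathcal N}$-equivalent if there is a crystal isomorphism $C(b_1)\to C(b_2)$ sending $b_1$ to $b_2$. Crystal of words: $\mathbf W$ is the set of finite words in $\mathcal N$ (including the empty word), $\mathrm{wt}(w_1\cdots w_r)=\sum_k\epsilon_{w_k}$. On letters, $f_i(i)=i+\frac12$, $e_i(i+\frac12)=i$, all other $e_i,f_i$ give $\mathbf 0$. On $w=w_1\cdots w_r$: for $i\in\mathbb Z_{>0}$ (resp. $i\in\frac12+\mathbb Z_{\ge0}$) let $k$ be the smallest (resp. largest) index with $w_k\in\{i,i+\frac12\}$; $e_iw$, $f_iw$ are obtained by applying $e_i$, $f_i$ to $w_k$ ($\mathbf 0$ if that gives $\mathbf 0$); if no such $k$ exists, $e_iw=f_iw=\mathbf 0$. $\varepsilon_i(w)=1$ if $e_iw\neq\mathbf 0$, else $0$; $\varphi_i(w)=1$ if $f_iw\ne\mathbf 0$, else $0$. A composition $\alpha=(\alpha_1,\dots,\alpha_t)$ (finite sequence of positive integers, the empty one allowed) is identified with its ribbon diagram: rows from top to bottom have $\alpha_1,\dots,\alpha_t$ nodes, and the leftmost node of row $i+1$ is directly below the rightmost node of row $i$. A quasi-ribbon tableau of shape $\alpha$ is a filling with entries in $\mathcal N$ weakly increasing along rows (left to right) and columns (top to bottom), with integers strictly increasing in each column and odd half-integers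 strictly increasing in each row; $\mathbf B(\alpha)$ is the set of these. A quasi-ribbon tableau is an element of $\mathbf B(\alpha)$ for some composition $\alpha$. $w(T)$ is the word obtained by reading rows from top to bottom, each row right to left; $\mathbf B(\alpha)$ is a $\mathfrak{gl}_{\mathcal N}$-crystal by identifying $T$ with $w(T)\in\mathbf W$. *)

theory Defs
  imports Complex_Main "HOL-Library.Poly_Mapping"
begin

section \<open>The index set of positive half-integers\<close>

text \<open>The set of all \<open>n/2\<close> with \<open>n\<close> a positive integer serves both as the alphabet and as
  the set of colours of the crystal operators.\<close>

typedef half_pos = "{q :: rat. \<exists>n::nat. n > 0 \<and> q = of_nat n / 2}"
  morphisms rat_of_half Half
  by (rule exI[of _ "1/2"], rule CollectI, rule exI[of _ 1]) simp

instantiation half_pos :: linorder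
begin

definition less_eq_half_pos :: "half_pos \<Rightarrow> half_pos \<Rightarrow> bool" where
  "a \<le> b \<longleftrightarrow> rat_of_half a \<le> rat_of_half b"

definition less_half_pos :: "half_pos \<Rightarrow> half_pos \<Rightarrow> bool" where
  "a < b \<longleftrightarrow> rat_of_half a < rat_of_half b"

instance
  by standard (auto simp: less_eq_half_pos_def less_half_pos_def rat_of_half_inject)

end

definition is_integer :: "half_pos \<Rightarrow> bool" where
  "is_integer a \<longleftrightarrow> rat_of_half a \<in> \<int>"

definition parity :: "half_pos \<Rightarrow> nat" where
  "parity a = (if is_integer a then 0 else 1)"

definition next_half :: "half_pos \<Rightarrow> half_pos" where
  "next_half a = Half (rat_of_half a + 1/2)"

lemma rat_of_half_next_half: "rat_of_half (next_half a) = rat_of_half a + 1/2"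
proof -
  from rat_of_half[of a] obtain n :: nat where "rat_of_half a = of_nat n / 2" by auto
  then have "rat_of_half a + 1/2 = of_nat (Suc n) / 2" by (simp add: add_divide_distrib)
  then show ?thesis
    unfolding next_half_def by (intro Half_inverse CollectI exI[of _ "Suc n"]) simp
qed


section \<open>Weights\<close>

type_synonym weight = "half_pos \<Rightarrow>\<^sub>0 int"

definition eps_basis :: "half_pos \<Rightarrow> weight" where
  "eps_basis a = Poly_Mapping.single a 1"

definition pairing :: "weight \<Rightarrow> weight \<Rightarrow> int" where
  "pairing x y =
     (\<Sum>a\<in>Poly_Mapping.keys x. (-1) ^ parity a * Poly_Mapping.lookup x a * Poly_Mapping.lookup y a)"

lemma pairing_eps_basis:
  "pairing (eps_basis a) (eps_basis b) = (if a = b then (-1) ^ parity a else 0)"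
  by (simp add: pairing_def eps_basis_def lookup_single)

definition simple_root :: "half_pos \<Rightarrow> weight" where
  "simple_root i = eps_basis i - eps_basis (next_half i)"


section \<open>Crystals\<close>

text \<open>The formal symbol \<open>0\<close> adjoined to a crystal is rendered by \<^const>\<open>None\<close>.\<close>

record 'b crystal =
  elems :: "'b set"
  wt :: "'b \<Rightarrow> weight"
  eps :: "half_pos \<Rightarrow> 'b \<Rightarrow> nat"
  phi :: "half_pos \<Rightarrow> 'b \<Rightarrow> nat"
  e_op :: "half_pos \<Rightarrow> 'b \<Rightarrow> 'b option"
  f_op :: "half_pos \<Rightarrow> 'b \<Rightarrow> 'b option"

locale gl_crystal =
  fixes B :: "'b crystal"
  assumes e_closed: "\<And>i b b'. b \<in> elems B \<Longrightarrow> e_op B i b = Some b' \<Longrightarrow> b' \<in> elems B"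
    and f_closed: "\<And>i b b'. b \<in> elems B \<Longrightarrow> f_op B i b = Some b' \<Longrightarrow> b' \<in> elems B"
    and phi_plus_eps: "\<And>i b. b \<in> elems B \<Longrightarrow>
      phi B i b + eps B i b = (if pairing (wt B b) (simple_root i) \<noteq> 0 then 1 else 0)"
    and e_step: "\<And>i b b'. b \<in> elems B \<Longrightarrow> e_op B i b = Some b' \<Longrightarrow>
      int (eps B i b') = int (eps B i b) - 1 \<and>
      int (phi B i b') = int (phi B i b) + 1 \<and>
      wt B b' = wt B b + simple_root i"
    and f_step: "\<And>i b b'. b \<in> elems B \<Longrightarrow> f_op B i b = Some b' \<Longrightarrow>
      int (eps B i b') = int (eps B i b) + 1 \<and>
      int (phi B i b') = int (phi B i b) - 1 \<and>
      wt B b' = wt B b - simple_root i"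
    and f_iff_e: "\<And>i b b'. b \<in> elems B \<Longrightarrow> b' \<in> elems B \<Longrightarrow>
      f_op B i b = Some b' \<longleftrightarrow> e_op B i b' = Some b"

definition arrows :: "'b crystal \<Rightarrow> ('b \<times> 'b) set" where
  "arrows B = {(b, b'). b \<in> elems B \<and> b' \<in> elems B \<and> (\<exists>i. f_op B i b = Some b')}"

definition component :: "'b crystal \<Rightarrow> 'b \<Rightarrow> 'b crystal" where
  "component B b = B\<lparr>elems := {b'. (b, b') \<in> (arrows B \<union> (arrows B)\<inverse>)\<^sup>*}\<rparr>"

definition crystal_iso :: "'b crystal \<Rightarrow> 'c crystal \<Rightarrow> ('b \<Rightarrow> 'c) \<Rightarrow> bool" where
  "crystal_iso B C \<psi> \<longleftrightarrow>
     bij_betw \<psi> (elems B) (elems C) \<and>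
     (\<forall>i. \<forall>b\<in>elems B. \<forall>b'\<in>elems B.
        f_op B i b = Some b' \<longleftrightarrow> f_op C i (\<psi> b) = Some (\<psi> b')) \<and>
     (\<forall>b\<in>elems B. wt C (\<psi> b) = wt B b) \<and>
     (\<forall>i. \<forall>b\<in>elems B. eps C i (\<psi> b) = eps B i b \<and> phi C i (\<psi> b) = phi B i b)"

definition gl_equivalent :: "'b crystal \<Rightarrow> 'b \<Rightarrow> 'c crystal \<Rightarrow> 'c \<Rightarrow> bool" where
  "gl_equivalent B b C c \<longleftrightarrow>
     gl_crystal B \<and> gl_crystal C \<and> b \<in> elems B \<and> c \<in> elems C \<and>
     (\<exists>\<psi>. crystal_iso (component B b) (component C c) \<psi> \<and> \<psi> b = c)"


section \<open>The crystal of words\<close>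

definition letter_e :: "half_pos \<Rightarrow> half_pos \<Rightarrow> half_pos option" where
  "letter_e i a = (if a = next_half i then Some i else None)"

definition letter_f :: "half_pos \<Rightarrow> half_pos \<Rightarrow> half_pos option" where
  "letter_f i a = (if a = i then Some (next_half i) else None)"

definition i_positions :: "half_pos \<Rightarrow> half_pos list \<Rightarrow> nat set" where
  "i_positions i w = {k. k < length w \<and> w ! k \<in> {i, next_half i}}"

definition active_position :: "half_pos \<Rightarrow> half_pos list \<Rightarrow> nat" where
  "active_position i w = (if is_integer i then Min (i_positions i w) else Max (i_positions i w))"

definition word_op ::
  "(half_pos \<Rightarrow> half_pos \<Rightarrow> half_pos option) \<Rightarrow> half_pos \<Rightarrow> half_pos list \<Rightarrow> half_pos list option" where
  "word_op g i w =
     (if i_positions i w = {} then None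
      else let k = active_position i w in map_option (\<lambda>a. w[k := a]) (g i (w ! k)))"

definition word_crystal :: "half_pos list crystal" where
  "word_crystal =
     \<lparr>elems = UNIV,
      wt = (\<lambda>w. \<Sum>a\<leftarrow>w. eps_basis a),
      eps = (\<lambda>i w. if word_op letter_e i w \<noteq> None then 1 else 0),
      phi = (\<lambda>i w. if word_op letter_f i w \<noteq> None then 1 else 0),
      e_op = word_op letter_e,
      f_op = word_op letter_f\<rparr>"


section \<open>Quasi-ribbon tableaux\<close>

definition composition :: "nat list \<Rightarrow> bool" where
  "composition \<alpha> \<longleftrightarrow> (\<forall>a\<in>set \<alpha>. a > 0)"

text \<open>Nodes are pairs (row, column), numbered from \<open>0\<close>, with rows growing downwards. Since the
  leftmost node of row \<open>i + 1\<close> lies below the rightmost node of row \<open>i\<close>, each row starts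
  \<open>\<alpha>\<^sub>i - 1\<close> columns to the right of the start of row \<open>i\<close>.\<close>

definition row_start :: "nat list \<Rightarrow> nat \<Rightarrow> nat" where
  "row_start \<alpha> i = (\<Sum>k<i. \<alpha> ! k - 1)"

definition ribbon :: "nat list \<Rightarrow> (nat \<times> nat) set" where
  "ribbon \<alpha> = {(i, j). i < length \<alpha> \<and> row_start \<alpha> i \<le> j \<and> j < row_start \<alpha> i + \<alpha> ! i}"

text \<open>A filling is a partial map on nodes, so that it carries its diagram as its domain.\<close>

type_synonym filling = "nat \<times> nat \<Rightarrow> half_pos option"

definition quasi_ribbon_tableaux :: "nat list \<Rightarrow> filling set" where
  "quasi_ribbon_tableaux \<alpha> = {T. dom T = ribbon \<alpha> \<and>
     (\<forall>i j j' a b. j < j' \<and> T (i, j) = Some a \<and> T (i, j') = Some b \<longrightarrow>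
        a \<le> b \<and> (\<not> is_integer a \<and> \<not> is_integer b \<longrightarrow> a < b)) \<and>
     (\<forall>i i' j a b. i < i' \<and> T (i, j) = Some a \<and> T (i', j) = Some b \<longrightarrow>
        a \<le> b \<and> (is_integer a \<and> is_integer b \<longrightarrow> a < b))}"

definition reading_word :: "nat list \<Rightarrow> filling \<Rightarrow> half_pos list" where
  "reading_word \<alpha> T =
     concat (map (\<lambda>i. rev (map (\<lambda>j. the (T (i, j))) [row_start \<alpha> i ..< row_start \<alpha> i + \<alpha> ! i]))
       [0 ..< length \<alpha>])"

text \<open>The crystal structure is transported from words along the injective map
  \<^const>\<open>reading_word\<close>, whose image on tableaux of a given shape is stable under the operators.\<close>

definition tableau_of_word :: "nat list \<Rightarrow> half_pos list \<Rightarrow> filling" where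
  "tableau_of_word \<alpha> = the_inv_into (quasi_ribbon_tableaux \<alpha>) (reading_word \<alpha>)"

definition tableau_crystal :: "nat list \<Rightarrow> filling crystal" where
  "tableau_crystal \<alpha> =
     \<lparr>elems = quasi_ribbon_tableaux \<alpha>,
      wt = (\<lambda>T. wt word_crystal (reading_word \<alpha> T)),
      eps = (\<lambda>i T. eps word_crystal i (reading_word \<alpha> T)),
      phi = (\<lambda>i T. phi word_crystal i (reading_word \<alpha> T)),
      e_op = (\<lambda>i T. map_option (tableau_of_word \<alpha>) (e_op word_crystal i (reading_word \<alpha> T))),
      f_op = (\<lambda>i T. map_option (tableau_of_word \<alpha>) (f_op word_crystal i (reading_word \<alpha> T)))\<rparr>"

end

theory Submission
  imports Defs "HOL-Library.Multiset"
begin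

text \<open>List the positions of a word by increasing letter, reading equal integers from right to left
  and equal odd half-integers from left to right. The operators \<open>e\<^sub>i\<close> and \<open>f\<^sub>i\<close> preserve this list:
  the active letter is always the last \<open>i\<close> or the first \<open>i + 1/2\<close> in it. A word thus amounts to a
  permutation together with a weakly increasing sequence of letters, on which the operators act in a
  way that depends only on the descents of the permutation. The reading words of the quasi-ribbon
  tableaux of shape \<open>\<alpha>\<close> are the words belonging to one permutation, with a descent between any two
  adjacent nodes of a row of \<open>\<alpha>\<close> and no others, and every descent set arises in this way from a composition.
  Conversely the weight determines the increasing sequence, and the component determines the descents.\<close>


subsection \<open>The alphabet\<close>

text \<open>The tie rule of the list is forced by the two conventions for the active letter. For
  integral \<open>i\<close> it is the leftmost occurrence of \<open>i\<close> or
  \<open>next_half i\<close>; integers are listed right to left and odd letters left to right, so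
  this is the last \<open>i\<close> or else the first \<open>next_half i\<close>. For odd
  \<open>i\<close> all directions are reversed. In both cases it sits at the border between the two
  adjacent runs, so moving it by half a step keeps the list sorted with the same permutation.

  Two points shape the rest. Isomorphisms are required on connected components, which are hard to
  describe; they are built instead on the set of all words sharing a permutation, which is closed
  under the operators, and then restricted. In the other direction an arbitrary isomorphism is known
  only to respect weights and arrows and says nothing about permutations. So a descent has to be
  detected by an actual sequence of moves inside the component, ending where two neighbouring
  letters of the sorted sequence would become equal.\<close>

definition half_index :: "half_pos \<Rightarrow> nat" where
  "half_index a = (THE n. rat_of_half a = of_nat n / 2)"

text \<open>Doubling carries the alphabet into \<open>nat\<close>: the order becomes that of
  \<open>nat\<close>, \<open>next_half\<close> becomes \<open>Suc\<close>, and integrality becomes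
  evenness.\<close>

lemma rat_of_half_index: "rat_of_half a = of_nat (half_index a) / 2"
proof -
  obtain n :: nat where n: "rat_of_half a = of_nat n / 2"
    using rat_of_half[of a] by auto
  then have "half_index a = n"
    unfolding half_index_def by (intro the_equality) auto
  with n show ?thesis by simp
qed

lemma half_index_inject: "half_index a = half_index b \<longleftrightarrow> a = b"
  by (metis rat_of_half_index rat_of_half_inject)

lemma half_index_le: "a \<le> b \<longleftrightarrow> half_index a \<le> half_index b"
  by (simp add: less_eq_half_pos_def rat_of_half_index)

lemma half_index_less: "a < b \<longleftrightarrow> half_index a < half_index b"
  by (simp add: less_half_pos_def rat_of_half_index)

lemma half_index_next [simp]: "half_index (next_half a) = Suc (half_index a)"
proof -
  have "of_nat (half_index (next_half a)) / 2 = (of_nat (half_index a) / 2 + 1/2 :: rat)"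
    using rat_of_half_next_half[of a] by (simp add: rat_of_half_index)
  then have "of_nat (half_index (next_half a)) = (of_nat (Suc (half_index a)) :: rat)"
    by simp
  then show ?thesis by (simp only: of_nat_eq_iff)
qed

lemma is_integer_iff: "is_integer a \<longleftrightarrow> even (half_index a)"
proof
  assume "is_integer a"
  then obtain z where "rat_of_half a = of_int z"
    unfolding is_integer_def by (elim Ints_cases)
  then have "of_int (int (half_index a)) = (of_int (2 * z) :: rat)"
    by (simp add: rat_of_half_index)
  then have "int (half_index a) = 2 * z" by (simp only: of_int_eq_iff)
  then show "even (half_index a)" by presburger
next
  assume "even (half_index a)"
  then obtain m where "half_index a = 2 * m" by (elim evenE)
  then show "is_integer a" by (simp add: is_integer_def rat_of_half_index)
qed

lemma is_integer_next [simp]: "is_integer (next_half a) \<longleftrightarrow> \<not> is_integer a"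
  by (simp add: is_integer_iff)

lemma less_next [simp]: "a < next_half a"
  by (simp add: half_index_less)

lemma next_neq [simp]: "next_half a \<noteq> a" "a \<noteq> next_half a"
  by (simp_all flip: half_index_inject)

lemma less_next_iff: "a < next_half b \<longleftrightarrow> a \<le> b"
  by (simp add: half_index_less half_index_le less_Suc_eq_le)

lemma next_le_iff: "next_half a \<le> b \<longleftrightarrow> a < b"
  by (simp add: half_index_less half_index_le Suc_le_eq)


subsection \<open>The crystal of words\<close>

text \<open>A relational form of \<open>active_position\<close>: it is simply false when there are
  no candidates, and it can be checked by comparing with one position at a time.\<close>

definition active :: "half_pos \<Rightarrow> half_pos list \<Rightarrow> nat \<Rightarrow> bool" where
  "active i w x \<longleftrightarrow> x \<in> i_positions i w \<and>
     (\<forall>y\<in>i_positions i w. if is_integer i then x \<le> y else y \<le> x)"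

lemma finite_i_positions [simp]: "finite (i_positions i w)"
  by (simp add: i_positions_def)

lemma active_unique: "active i w x \<Longrightarrow> active i w y \<Longrightarrow> x = y"
  by (auto simp: active_def split: if_splits intro: antisym)

lemma active_active_position: "i_positions i w \<noteq> {} \<Longrightarrow> active i w (active_position i w)"
  by (auto simp: active_def active_position_def)

lemma active_bound: "active i w x \<Longrightarrow> x < length w"
  by (simp add: active_def i_positions_def)

lemma active_letter: "active i w x \<Longrightarrow> w ! x = i \<or> w ! x = next_half i"
  by (auto simp: active_def i_positions_def)

lemma word_op_active:
  assumes "active i w x"
  shows "word_op g i w = map_option (\<lambda>a. w[x := a]) (g i (w ! x))"
proof -
  have "i_positions i w \<noteq> {}" using assms by (auto simp: active_def)
  moreover from this have "active_position i w = x"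
    using active_active_position active_unique assms by blast
  ultimately show ?thesis by (simp add: word_op_def)
qed

lemma word_op_Some_iff:
  "word_op g i w = Some w' \<longleftrightarrow> (\<exists>x a. active i w x \<and> g i (w ! x) = Some a \<and> w' = w[x := a])"
proof
  assume *: "word_op g i w = Some w'"
  then have "i_positions i w \<noteq> {}" by (auto simp: word_op_def)
  note active = active_active_position[OF this]
  from active * word_op_active[OF active, of g]
  show "\<exists>x a. active i w x \<and> g i (w ! x) = Some a \<and> w' = w[x := a]"
    by auto
qed (auto simp: word_op_active)

lemma word_f_iff:
  "word_op letter_f i w = Some w' \<longleftrightarrow> (\<exists>x. active i w x \<and> w ! x = i \<and> w' = w[x := next_half i])"
  by (auto simp: word_op_Some_iff letter_f_def split: if_splits)

lemma word_e_iff: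
  "word_op letter_e i w = Some w' \<longleftrightarrow> (\<exists>x. active i w x \<and> w ! x = next_half i \<and> w' = w[x := i])"
  by (auto simp: word_op_Some_iff letter_e_def split: if_splits)

lemma i_positions_update:
  "x \<in> i_positions i w \<Longrightarrow> a \<in> {i, next_half i} \<Longrightarrow> i_positions i (w[x := a]) = i_positions i w"
  by (auto simp: i_positions_def nth_list_update)

text \<open>Exchanging \<open>i\<close> and \<open>next_half i\<close> does not change the set of
  candidates, so the same position stays active. This makes the two operators mutually inverse and
  keeps every \<open>i\<close>-string at length at most one.\<close>

lemma active_update:
  "active i w x \<Longrightarrow> a \<in> {i, next_half i} \<Longrightarrow> active i (w[x := a]) y = active i w y"
  unfolding active_def by (metis i_positions_update)

lemma word_f_iff_e: "word_op letter_f i w = Some w' \<longleftrightarrow> word_op letter_e i w' = Some w"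
proof
  assume "word_op letter_f i w = Some w'"
  then obtain x where x: "active i w x" "w ! x = i" "w' = w[x := next_half i]"
    by (auto simp: word_f_iff)
  then have "active i w' x" by (simp add: active_update)
  moreover have "w' ! x = next_half i" "w = w'[x := i]"
    using x active_bound[OF x(1)] list_update_id[of w x] by auto
  ultimately show "word_op letter_e i w' = Some w" by (auto simp: word_e_iff)
next
  assume "word_op letter_e i w' = Some w"
  then obtain x where x: "active i w' x" "w' ! x = next_half i" "w = w'[x := i]"
    by (auto simp: word_e_iff)
  then have "active i w x" by (simp add: active_update)
  moreover have "w ! x = i" "w' = w[x := next_half i]"
    using x active_bound[OF x(1)] list_update_id[of w' x] by auto
  ultimately show "word_op letter_f i w = Some w'" by (auto simp: word_f_iff)
qed

lemma word_crystal_simps [simp]: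
  "elems word_crystal = UNIV"
  "f_op word_crystal = word_op letter_f"
  "e_op word_crystal = word_op letter_e"
  "eps word_crystal i w = (if word_op letter_e i w \<noteq> None then 1 else 0)"
  "phi word_crystal i w = (if word_op letter_f i w \<noteq> None then 1 else 0)"
  by (simp_all add: word_crystal_def)

lemma wt_word: "wt word_crystal w = (\<Sum>a\<leftarrow>w. eps_basis a)"
  by (simp add: word_crystal_def)

lemma wt_update:
  "x < length w \<Longrightarrow> wt word_crystal (w[x := a]) = wt word_crystal w - eps_basis (w ! x) + eps_basis a"
  by (induction w arbitrary: x) (auto simp: wt_word split: nat.split)

lemma lookup_wt_word: "Poly_Mapping.lookup (wt word_crystal w) a = int (count (mset w) a)"
  by (induction w) (auto simp: wt_word lookup_add eps_basis_def lookup_single when_def)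

text \<open>The coefficient of the weight at \<open>a\<close> counts the letters \<open>a\<close>,
  so a weight-preserving map keeps all letters with multiplicity.\<close>

lemma wt_word_eq_iff: "wt word_crystal v = wt word_crystal w \<longleftrightarrow> mset v = mset w"
proof
  assume "wt word_crystal v = wt word_crystal w"
  then show "mset v = mset w"
    by (metis lookup_wt_word multiset_eqI of_nat_eq_iff)
next
  assume "mset v = mset w"
  then show "wt word_crystal v = wt word_crystal w"
    by (intro poly_mapping_eqI) (simp add: lookup_wt_word)
qed

text \<open>The form has opposite signs at \<open>i\<close> and \<open>next_half i\<close>, which
  cancels the minus sign in the simple root. For a word both coefficients are counts, so their sum
  vanishes only if both letters are absent.\<close>

lemma pairing_simple_root:
  "pairing x (simple_root i) =
     (-1) ^ parity i * (Poly_Mapping.lookup x i + Poly_Mapping.lookup x (next_half i))"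
proof -
  let ?S = "Poly_Mapping.keys x \<union> {i, next_half i}"
  let ?h = "\<lambda>a. (-1) ^ parity a * Poly_Mapping.lookup x a * Poly_Mapping.lookup (simple_root i) a"
  have "pairing x (simple_root i) = (\<Sum>a\<in>?S. ?h a)"
    unfolding pairing_def by (intro sum.mono_neutral_left) (auto simp: in_keys_iff)
  also have "\<dots> = (\<Sum>a\<in>{i, next_half i}. ?h a)"
    by (intro sum.mono_neutral_right)
      (auto simp: simple_root_def eps_basis_def lookup_minus lookup_single when_def)
  also have "\<dots> = (-1) ^ parity i * (Poly_Mapping.lookup x i + Poly_Mapping.lookup x (next_half i))"
    by (simp add: simple_root_def eps_basis_def lookup_minus lookup_single when_def
        parity_def algebra_simps)
  finally show ?thesis .
qed

lemma pairing_wt_word: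
  "pairing (wt word_crystal w) (simple_root i) \<noteq> 0 \<longleftrightarrow> i_positions i w \<noteq> {}"
proof -
  have "pairing (wt word_crystal w) (simple_root i) \<noteq> 0 \<longleftrightarrow> i \<in> set w \<or> next_half i \<in> set w"
    by (simp add: pairing_simple_root lookup_wt_word)
      (metis add_eq_0_iff_both_eq_0 count_mset_0_iff of_nat_0_eq_iff of_nat_add)
  also have "\<dots> \<longleftrightarrow> i_positions i w \<noteq> {}"
    by (auto simp: i_positions_def in_set_conv_nth)
  finally show ?thesis .
qed

lemma word_f_eps_phi:
  assumes "word_op letter_f i w = Some w'"
  shows "word_op letter_e i w = None" "word_op letter_f i w' = None"
proof -
  obtain x where x: "active i w x" "w ! x = i" "w' = w[x := next_half i]"
    using assms by (auto simp: word_f_iff)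
  show "word_op letter_e i w = None"
    using x by (simp add: word_op_active letter_e_def)
  have "active i w' x" using x by (simp add: active_update)
  then show "word_op letter_f i w' = None"
    using x active_bound[OF x(1)] by (simp add: word_op_active letter_f_def)
qed

lemma wt_word_f:
  assumes "word_op letter_f i w = Some w'"
  shows "wt word_crystal w' = wt word_crystal w - simple_root i"
  using assms by (auto simp: word_f_iff simple_root_def wt_update dest!: active_bound)

lemma gl_crystal_word: "gl_crystal word_crystal"
proof (standard, goal_cases)
  case (3 i w)
  show ?case
  proof (cases "i_positions i w = {}")
    case True
    then show ?thesis using pairing_wt_word[of w i] by (simp add: word_op_def)
  next
    case False
    from active_active_position[OF this] obtain x where x: "active i w x" ..
    with active_letter[OF x] False pairing_wt_word[of w i] show ?thesis
      by (auto simp: word_op_active letter_e_def letter_f_def)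
  qed
next
  case (4 i w w')
  then have "word_op letter_f i w' = Some w" by (simp add: word_f_iff_e)
  with 4 word_f_eps_phi[OF this] wt_word_f[OF this] show ?case by simp
next
  case (5 i w w')
  then have "word_op letter_f i w = Some w'" by simp
  moreover from this have "word_op letter_e i w' = Some w" by (simp add: word_f_iff_e)
  ultimately show ?case using word_f_eps_phi[of i w w'] wt_word_f[of i w w'] by simp
qed (simp_all add: word_f_iff_e)


subsection \<open>Standardization\<close>

text \<open>The common language for words and tableaux: \<open>D\<close> will be the descents of a
  permutation, or the steps along a ribbon that stay in one row.\<close>

definition compatible :: "nat \<Rightarrow> (nat \<Rightarrow> bool) \<Rightarrow> (nat \<Rightarrow> half_pos) \<Rightarrow> bool" where
  "compatible n D a \<longleftrightarrow> (\<forall>k. Suc k < n \<longrightarrow>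
     a k < a (Suc k) \<or> a k = a (Suc k) \<and> (is_integer (a k) \<longleftrightarrow> D k))"

definition descent :: "(nat \<Rightarrow> nat) \<Rightarrow> nat \<Rightarrow> bool" where
  "descent p k \<longleftrightarrow> p (Suc k) < p k"

text \<open>\<open>p\<close> lists the positions of \<open>w\<close> by increasing letter, where equal integers are listed from
  right to left and equal odd half-integers from left to right.\<close>

definition standardizes :: "nat \<Rightarrow> (nat \<Rightarrow> nat) \<Rightarrow> half_pos list \<Rightarrow> bool" where
  "standardizes n p w \<longleftrightarrow> length w = n \<and> bij_betw p {..<n} {..<n} \<and>
     compatible n (descent p) (\<lambda>k. w ! p k)"

lemma compatible_cong:
  assumes "\<And>k. k < n \<Longrightarrow> a k = b k" "\<And>k. Suc k < n \<Longrightarrow> D k = D' k"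
  shows "compatible n D a \<longleftrightarrow> compatible n D' b"
  unfolding compatible_def using assms by (metis Suc_lessD)

lemma compatible_mono:
  assumes "compatible n D a" "k \<le> l" "l < n"
  shows "a k \<le> a l"
  using assms(2,3)
proof (induction l rule: dec_induct)
  case (step l)
  then show ?case using assms(1) unfolding compatible_def
    by (metis Suc_lessD less_imp_le order.trans order_refl)
qed simp

text \<open>Monotonicity squeezes all values between \<open>k\<close> and \<open>l\<close> to one
  letter, so every step in between is a tie and its parity decides \<open>D\<close> there.\<close>

lemma compatible_constant:
  assumes "compatible n D a" "k \<le> l" "l < n" "a k = a l" "k \<le> m" "m < l"
  shows "a m = a k" "is_integer (a k) \<longleftrightarrow> D m"
proof -
  have "a k \<le> a m" "a m \<le> a (Suc m)" "a (Suc m) \<le> a l"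
    using compatible_mono[OF assms(1)] assms(2,3,5,6) by simp_all
  with assms(4) have *: "a m = a k" "a (Suc m) = a k" by auto
  then show "a m = a k" by simp
  show "is_integer (a k) \<longleftrightarrow> D m"
    using assms(1,3,6) * unfolding compatible_def
    by (metis Suc_leI order.strict_trans1 order_less_irrefl)
qed

lemma standardizes_bij: "standardizes n p w \<Longrightarrow> bij_betw p {..<n} {..<n}"
  by (simp add: standardizes_def)

lemma standardizes_less: "standardizes n p w \<Longrightarrow> k < n \<Longrightarrow> p k < length w"
  using bij_betwE[of p] by (fastforce simp: standardizes_def)

lemma standardizes_eq_iff: "standardizes n p w \<Longrightarrow> k < n \<Longrightarrow> l < n \<Longrightarrow> p k = p l \<longleftrightarrow> k = l"
  by (auto simp: standardizes_def bij_betw_def inj_on_def)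

lemma standardizes_obtain:
  assumes "standardizes n p w" "x < length w"
  obtains k where "k < n" "p k = x"
proof -
  have "x \<in> p ` {..<n}" using assms by (simp add: standardizes_def bij_betw_def)
  then show thesis using that by auto
qed

lemma standardizes_i_positions:
  "standardizes n p w \<Longrightarrow> i_positions i w = p ` {k. k < n \<and> w ! p k \<in> {i, next_half i}}"
  by (auto simp: i_positions_def standardizes_less image_iff) (metis standardizes_obtain)+

text \<open>Along a run of equal letters all steps are descents (integers) or none is (odd letters),
  so \<open>p\<close> is monotone on the run.\<close>

lemma standardizes_tie_le:
  assumes w: "standardizes n p w" and "k \<le> l" "l < n" "w ! p k = w ! p l"
  shows "if is_integer (w ! p k) then p l \<le> p k else p k \<le> p l"
proof -
  have c: "compatible n (descent p) (\<lambda>k. w ! p k)"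
    using w by (simp add: standardizes_def)
  have *: "is_integer (w ! p k) \<longleftrightarrow> descent p m" if "k \<le> m" "m < l" for m
    using compatible_constant(2)[OF c assms(2,3,4) that] .
  from assms(2) show ?thesis using *
  proof (induction l rule: dec_induct)
    case (step l)
    then have "if is_integer (w ! p k) then p l \<le> p k else p k \<le> p l" by simp
    then show ?case using step.prems[of l] step.hyps by (auto simp: descent_def split: if_splits)
  qed simp
qed

lemma standardizes_update:
  assumes w: "standardizes n p w" and k: "k < n"
  shows "standardizes n p (w[p k := a]) \<longleftrightarrow> compatible n (descent p) ((\<lambda>k. w ! p k)(k := a))"
proof -
  have "compatible n (descent p) (\<lambda>l. w[p k := a] ! p l) \<longleftrightarrow>
        compatible n (descent p) ((\<lambda>k. w ! p k)(k := a))"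
    using w k
    by (intro compatible_cong) (auto simp: standardizes_less standardizes_eq_iff nth_list_update)
  then show ?thesis using w by (simp add: standardizes_def)
qed

text \<open>Only the step from \<open>k\<close> to \<open>Suc k\<close> can be spoiled, since the
  letter before place \<open>k\<close> is at most \<open>i\<close>. The next letter is not another
  \<open>i\<close>: the tie rule would then contradict the extremality of the active position. If it
  is \<open>next_half i\<close>, that same extremality yields the descent status which the new tie
  needs.\<close>

lemma standardizes_f_imp:
  assumes w: "standardizes n p w" and f: "word_op letter_f i w = Some w'"
  shows "standardizes n p w'"
proof -
  obtain x where x: "active i w x" "w ! x = i" "w' = w[x := next_half i]"
    using f by (auto simp: word_f_iff)
  then obtain k where k: "k < n" "p k = x"
    using w active_bound by (metis standardizes_obtain)
  define a where "a = (\<lambda>k. w ! p k)"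
  have c: "compatible n (descent p) a"
    using w by (simp add: standardizes_def a_def)
  have ak: "a k = i" using x k by (simp add: a_def)
  have act: "if is_integer i then p k \<le> p l else p l \<le> p k"
    if "l < n" "a l \<in> {i, next_half i}" for l
    using x(1) k that by (auto simp: active_def a_def standardizes_i_positions[OF w])
  have "compatible n (descent p) (a(k := next_half i))"
    unfolding compatible_def
  proof (intro allI impI)
    fix m assume m: "Suc m < n"
    consider "m = k" | "Suc m = k" | "m \<noteq> k" "Suc m \<noteq> k" by blast
    then show "(a(k := next_half i)) m < (a(k := next_half i)) (Suc m) \<or>
      (a(k := next_half i)) m = (a(k := next_half i)) (Suc m) \<and>
      is_integer ((a(k := next_half i)) m) = descent p m"
    proof cases
      case 1
      have neq: "p (Suc k) \<noteq> p k" using m 1 standardizes_eq_iff[OF w, of "Suc k" k] by auto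
      have *: "a k < a (Suc k) \<or> a k = a (Suc k) \<and> (is_integer (a k) \<longleftrightarrow> descent p k)"
        using c m 1 by (simp add: compatible_def)
      have act': "if is_integer i then p k < p (Suc k) else p (Suc k) < p k"
        if "a (Suc k) \<in> {i, next_half i}"
        using act[of "Suc k"] m 1 neq that by (metis le_neq_implies_less)
      have "a (Suc k) \<noteq> i"
        using * act' ak unfolding descent_def by (metis insertI1 not_less_iff_gr_or_eq)
      then have "next_half i \<le> a (Suc k)" using * ak by (auto simp: next_le_iff)
      moreover have "is_integer (next_half i) \<longleftrightarrow> descent p k" if "a (Suc k) = next_half i"
        using act' that by (auto simp: descent_def split: if_splits)
      ultimately show ?thesis using 1 by auto
    next
      case 2
      then have "a m \<le> i" using compatible_mono[OF c, of m k] ak k by simp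
      then show ?thesis using 2 by (auto simp: less_next_iff)
    next
      case 3
      then show ?thesis using c m by (simp add: compatible_def)
    qed
  qed
  then show ?thesis using standardizes_update[OF w k(1)] x k by (simp add: a_def)
qed

text \<open>The mirror image: lowering place \<open>k\<close> can only spoil the step that ends at
  \<open>k\<close>, and extremality of the active position again settles it.\<close>

lemma standardizes_e_imp:
  assumes w: "standardizes n p w" and f: "word_op letter_e i w = Some w'"
  shows "standardizes n p w'"
proof -
  obtain x where x: "active i w x" "w ! x = next_half i" "w' = w[x := i]"
    using f by (auto simp: word_e_iff)
  then obtain k where k: "k < n" "p k = x"
    using w active_bound by (metis standardizes_obtain)
  define a where "a = (\<lambda>k. w ! p k)"
  have c: "compatible n (descent p) a"
    using w by (simp add: standardizes_def a_def)
  have ak: "a k = next_half i" using x k by (simp add: a_def)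
  have act: "if is_integer i then p k \<le> p l else p l \<le> p k"
    if "l < n" "a l \<in> {i, next_half i}" for l
    using x(1) k that by (auto simp: active_def a_def standardizes_i_positions[OF w])
  have "compatible n (descent p) (a(k := i))"
    unfolding compatible_def
  proof (intro allI impI)
    fix m assume m: "Suc m < n"
    consider "m = k" | "Suc m = k" | "m \<noteq> k" "Suc m \<noteq> k" by blast
    then show "(a(k := i)) m < (a(k := i)) (Suc m) \<or>
      (a(k := i)) m = (a(k := i)) (Suc m) \<and> is_integer ((a(k := i)) m) = descent p m"
    proof cases
      case 1
      then have "next_half i \<le> a (Suc m)" using compatible_mono[OF c, of k "Suc m"] ak m by simp
      then show ?thesis using 1 by (auto simp: next_le_iff)
    next
      case 2
      have neq: "p m \<noteq> p k" using m 2 standardizes_eq_iff[OF w, of m k] by auto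
      have *: "a m < a k \<or> a m = a k \<and> (is_integer (a m) \<longleftrightarrow> descent p m)"
        using c m 2 by (auto simp: compatible_def)
      have act': "if is_integer i then p k < p m else p m < p k"
        if "a m \<in> {i, next_half i}"
        using act[of m] m neq that by (metis Suc_lessD le_neq_implies_less)
      have "a m \<noteq> next_half i"
        using * act' ak 2 is_integer_next[of i] unfolding descent_def
        by (metis insertI1 insertI2 not_less_iff_gr_or_eq)
      then have "a m \<le> i" using * ak by (auto simp: less_next_iff)
      moreover have "is_integer i \<longleftrightarrow> descent p m" if "a m = i"
        using act' 2 that by (auto simp: descent_def split: if_splits)
      ultimately show ?thesis using 2 by auto
    next
      case 3
      then show ?thesis using c m by (simp add: compatible_def)
    qed
  qed
  then show ?thesis using standardizes_update[OF w k(1)] x k by (simp add: a_def)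
qed

text \<open>This removes positions from the description of the operator: what remains is raising one
  term of the sorted sequence so that it stays compatible with the descents. Everything about
  isomorphisms rests on this form.\<close>

lemma standardizes_f_iff:
  assumes w: "standardizes n p w"
  shows "word_op letter_f i w = Some w' \<longleftrightarrow>
    (\<exists>k<n. w ! p k = i \<and> w' = w[p k := next_half i] \<and> standardizes n p w')"
proof
  assume f: "word_op letter_f i w = Some w'"
  then obtain x where x: "active i w x" "w ! x = i" "w' = w[x := next_half i]"
    by (auto simp: word_f_iff)
  then obtain k where "k < n" "p k = x"
    using w active_bound by (metis standardizes_obtain)
  with x standardizes_f_imp[OF w f]
  show "\<exists>k<n. w ! p k = i \<and> w' = w[p k := next_half i] \<and> standardizes n p w'" by auto
next
  assume "\<exists>k<n. w ! p k = i \<and> w' = w[p k := next_half i] \<and> standardizes n p w'"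
  then obtain k where k: "k < n" "w ! p k = i" "w' = w[p k := next_half i]"
    and w': "standardizes n p w'" by blast
  have pos: "p k \<in> i_positions i w"
    using k by (auto simp: standardizes_i_positions[OF w])
  have w'k: "w' ! p k = next_half i"
    using k standardizes_less[OF w] by simp
  have "if is_integer i then p k \<le> p l else p l \<le> p k"
    if l: "l < n" "w ! p l \<in> {i, next_half i}" for l
  \<comment> \<open>Candidates up to \<open>k\<close> all equal \<open>i\<close> and are compared
    with \<open>p k\<close> by the tie rule of \<open>w\<close>. Candidates beyond \<open>k\<close>
    all equal \<open>next_half i\<close>, as place \<open>k\<close> does in \<open>w'\<close>, so
    the tie rule of \<open>w'\<close> compares them.\<close>
  proof (cases "l \<le> k")
    case True
    have "w ! p l \<le> i"
      using compatible_mono[of n "descent p" "\<lambda>k. w ! p k" l k] w True k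
      by (simp add: standardizes_def)
    then have "w ! p l = i" using l less_next[of i] by (auto simp del: less_next)
    then show ?thesis using standardizes_tie_le[OF w True k(1)] k by simp
  next
    case False
    then have eq: "w' ! p l = w ! p l"
      using k l standardizes_eq_iff[OF w, of k l] by simp
    have "next_half i \<le> w' ! p l"
      using compatible_mono[of n "descent p" "\<lambda>k. w' ! p k" k l] w' False l w'k
      by (simp add: standardizes_def)
    then have "w' ! p l = next_half i" using l eq less_next[of i] by (auto simp del: less_next)
    then show ?thesis using standardizes_tie_le[OF w', of k l] False l w'k by simp
  qed
  then have "active i w (p k)"
    using pos by (auto simp: active_def standardizes_i_positions[OF w])
  then show "word_op letter_f i w = Some w'"
    using k by (auto simp: word_f_iff)
qed

lemma ex_standardizes: "\<exists>p. standardizes (length w) p w"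
proof -
  define n where "n = length w"
  \<comment> \<open>A lexicographic pair packed into one number: the letter first, then the
    position, reversed for integers. The second part is at most \<open>n\<close>, hence the factor
    \<open>Suc n\<close>.\<close>
  define key where "key x = half_index (w ! x) * Suc n + (if is_integer (w ! x) then n - x else x)" for x
  have less: "half_index (w ! x) < half_index (w ! y) \<Longrightarrow> key x < key y" if "x < n" "y < n" for x y
  proof -
    assume *: "half_index (w ! x) < half_index (w ! y)"
    have "key x < Suc (half_index (w ! x)) * Suc n" using that by (auto simp: key_def)
    also have "\<dots> \<le> half_index (w ! y) * Suc n" using * by (intro mult_right_mono) auto
    also have "\<dots> \<le> key y" by (simp add: key_def)
    finally show ?thesis .
  qed
  have inj: "inj_on key {..<n}"
  proof (rule inj_onI)
    fix x y assume xy: "x \<in> {..<n}" "y \<in> {..<n}" "key x = key y"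
    then have "w ! x = w ! y"
      using less[of x y] less[of y x]
      by (metis half_index_inject less_irrefl lessThan_iff linorder_neqE_nat)
    with xy show "x = y" by (auto simp: key_def split: if_splits)
  qed
  define xs where "xs = sort_key key [0..<n]"
  have xs: "distinct xs" "set xs = {..<n}" "length xs = n"
    by (auto simp: xs_def)
  have bij: "bij_betw ((!) xs) {..<n} {..<n}"
    by (intro bij_betw_nth) (simp_all add: xs)
  have "compatible n (descent ((!) xs)) (\<lambda>k. w ! (xs ! k))"
    unfolding compatible_def
  proof (intro allI impI)
    fix k assume k: "Suc k < n"
    let ?x = "xs ! k" and ?y = "xs ! Suc k"
    have b: "?x < n" "?y < n" using k xs by (metis Suc_lessD lessThan_iff nth_mem)+
    have "?x \<noteq> ?y" using k xs by (simp add: nth_eq_iff_index_eq)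
    moreover have "sorted (map key xs)" by (simp add: xs_def)
    then have "key ?x \<le> key ?y"
      using k xs sorted_nth_mono[of "map key xs" k "Suc k"] by simp
    ultimately have "key ?x < key ?y"
      using b inj by (metis inj_onD lessThan_iff order_le_less)
    moreover from this have "half_index (w ! ?x) \<le> half_index (w ! ?y)"
      using less[of ?y ?x] b by fastforce
    ultimately show "w ! ?x < w ! ?y \<or> w ! ?x = w ! ?y \<and> (is_integer (w ! ?x) \<longleftrightarrow> descent ((!) xs) k)"
      using b by (auto simp: half_index_less descent_def key_def order_le_less half_index_inject
          split: if_splits)
  qed
  then show ?thesis using bij by (auto simp: standardizes_def n_def)
qed


subsection \<open>Isomorphisms of crystals\<close>

text \<open>In a \<open>gl_crystal\<close> these sets are the unions of connected
  components.\<close>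

definition closed_subset :: "'b crystal \<Rightarrow> 'b set \<Rightarrow> bool" where
  "closed_subset B X \<longleftrightarrow> X \<subseteq> elems B \<and>
     (\<forall>b\<in>X. \<forall>i b'. e_op B i b = Some b' \<or> f_op B i b = Some b' \<longrightarrow> b' \<in> X)"

lemma closed_subset_elems: "gl_crystal B \<Longrightarrow> closed_subset B (elems B)"
  by (auto simp: closed_subset_def intro: gl_crystal.e_closed gl_crystal.f_closed)

lemma component_simps [simp]:
  "elems (component B b) = {b'. (b, b') \<in> (arrows B \<union> (arrows B)\<inverse>)\<^sup>*}"
  "wt (component B b) = wt B" "eps (component B b) = eps B" "phi (component B b) = phi B"
  "e_op (component B b) = e_op B" "f_op (component B b) = f_op B"
  by (simp_all add: component_def)

lemma component_subset:
  assumes "gl_crystal B" "closed_subset B X" "b \<in> X"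
  shows "elems (component B b) \<subseteq> X"
proof
  fix c assume "c \<in> elems (component B b)"
  then have "(b, c) \<in> (arrows B \<union> (arrows B)\<inverse>)\<^sup>*" by simp
  then show "c \<in> X"
  proof (induction rule: rtrancl_induct)
    case (step c d)
    then obtain i where "f_op B i c = Some d \<or> f_op B i d = Some c"
      and "c \<in> elems B" "d \<in> elems B" by (auto simp: arrows_def)
    then have "f_op B i c = Some d \<or> e_op B i c = Some d"
      using gl_crystal.f_iff_e[OF assms(1)] by blast
    with step.IH assms(2) show ?case unfolding closed_subset_def by blast
  qed (use assms in simp)
qed

text \<open>Paths are carried forward by \<open>\<psi>\<close>. They also lift back: each vertex of
  a path from \<open>\<psi> b\<close> stays in \<open>Y\<close> and so has a preimage in
  \<open>X\<close>, and arrows between points of \<open>X\<close> are reflected.\<close>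

lemma crystal_iso_component:
  assumes B: "gl_crystal B" "closed_subset B X" and C: "gl_crystal C" "closed_subset C Y"
    and iso: "crystal_iso (B\<lparr>elems := X\<rparr>) (C\<lparr>elems := Y\<rparr>) \<psi>" and b: "b \<in> X"
  shows "crystal_iso (component B b) (component C (\<psi> b)) \<psi>"
proof -
  let ?K = "elems (component B b)" and ?L = "elems (component C (\<psi> b))"
  have bij: "bij_betw \<psi> X Y" using iso by (simp add: crystal_iso_def)
  have f: "f_op B i c = Some d \<longleftrightarrow> f_op C i (\<psi> c) = Some (\<psi> d)" if "c \<in> X" "d \<in> X" for i c d
    using iso that by (simp add: crystal_iso_def)
  have Y: "\<psi> b \<in> Y" using bij b by (auto simp: bij_betw_def)
  have XB: "X \<subseteq> elems B" and YC: "Y \<subseteq> elems C"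
    using B C by (auto simp: closed_subset_def)
  have KX: "?K \<subseteq> X" and LY: "?L \<subseteq> Y"
    using component_subset[OF B b] component_subset[OF C Y] by auto
  have arrow: "(c, d) \<in> arrows B \<longleftrightarrow> (\<psi> c, \<psi> d) \<in> arrows C" if "c \<in> X" "d \<in> X" for c d
    using that f[OF that] XB YC bij_betwE[OF bij] by (auto simp: arrows_def)
  have "\<psi> c \<in> ?L" if "c \<in> ?K" for c
  proof -
    from that have "(b, c) \<in> (arrows B \<union> (arrows B)\<inverse>)\<^sup>*" by simp
    then show "\<psi> c \<in> ?L"
    proof (induction rule: rtrancl_induct)
      case (step c d)
      then have "d \<in> ?K" by (auto intro: rtrancl_into_rtrancl)
      with step.hyps KX have "c \<in> X" "d \<in> X" by auto
      with step.hyps arrow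
      have "(\<psi> c, \<psi> d) \<in> arrows C \<union> (arrows C)\<inverse>" by auto
      with step.IH show ?case by (auto intro: rtrancl_into_rtrancl)
    qed simp
  qed
  moreover have "\<exists>c\<in>?K. d = \<psi> c" if "d \<in> ?L" for d
  proof -
    from that have "(\<psi> b, d) \<in> (arrows C \<union> (arrows C)\<inverse>)\<^sup>*" by simp
    then show ?thesis
    proof (induction rule: rtrancl_induct)
      case base
      show ?case by (intro bexI[of _ b]) auto
    next
      case (step d d')
      then obtain c where c: "c \<in> ?K" "d = \<psi> c" by blast
      have "d' \<in> ?L" using step.hyps by (auto intro: rtrancl_into_rtrancl)
      then obtain c' where c': "c' \<in> X" "d' = \<psi> c'"
        using LY bij by (auto simp: bij_betw_def)
      with c step.hyps(2) KX arrow
      have "(c, c') \<in> arrows B \<union> (arrows B)\<inverse>" by blast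
      with c have "c' \<in> ?K" by (auto intro: rtrancl_into_rtrancl)
      with c' show ?case by blast
    qed
  qed
  ultimately have "\<psi> ` ?K = ?L" by blast
  then have "bij_betw \<psi> ?K ?L"
    using bij KX by (metis bij_betw_subset)
  moreover have "wt C (\<psi> c) = wt B c" "eps C i (\<psi> c) = eps B i c" "phi C i (\<psi> c) = phi B i c"
    if "c \<in> X" for c i
    using iso that by (auto simp: crystal_iso_def)
  ultimately show ?thesis
    unfolding crystal_iso_def using KX f by (auto simp del: component_simps(1) simp: subset_iff)
qed

lemma crystal_iso_comp:
  assumes "crystal_iso B C \<psi>" "crystal_iso C D \<chi>"
  shows "crystal_iso B D (\<chi> \<circ> \<psi>)"
proof -
  have "\<psi> b \<in> elems C" if "b \<in> elems B" for b
    using assms(1) that by (auto simp: crystal_iso_def bij_betw_def)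
  then show ?thesis
    using assms unfolding crystal_iso_def by (auto intro: bij_betw_trans)
qed

lemma crystal_iso_inv:
  assumes "crystal_iso B C \<psi>"
  shows "crystal_iso C B (the_inv_into (elems B) \<psi>)"
proof -
  let ?\<chi> = "the_inv_into (elems B) \<psi>"
  have bij: "bij_betw \<psi> (elems B) (elems C)" using assms by (simp add: crystal_iso_def)
  have *: "?\<chi> c \<in> elems B" "\<psi> (?\<chi> c) = c" if "c \<in> elems C" for c
    using bij that by (auto simp: bij_betw_def the_inv_into_into f_the_inv_into_f)
  have "f_op C i c = Some d \<longleftrightarrow> f_op B i (?\<chi> c) = Some (?\<chi> d)"
    if "c \<in> elems C" "d \<in> elems C" for i c d
    using assms *[OF that(1)] *[OF that(2)] by (simp add: crystal_iso_def)
  moreover have "wt B (?\<chi> c) = wt C c" "eps B i (?\<chi> c) = eps C i c" "phi B i (?\<chi> c) = phi C i c"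
    if "c \<in> elems C" for i c
    using assms *[OF that] unfolding crystal_iso_def by metis+
  ultimately show ?thesis
    using bij_betw_the_inv_into[OF bij] by (simp add: crystal_iso_def)
qed


text \<open>Lets a whole crystal take the place of a restricted one in
  \<open>crystal_iso_component\<close>.\<close>

lemma elems_update_id: "B\<lparr>elems := elems B\<rparr> = B"
  by simp


subsection \<open>Words with a fixed standardization\<close>

definition words_with :: "nat \<Rightarrow> (nat \<Rightarrow> nat) \<Rightarrow> half_pos list crystal" where
  "words_with n p = word_crystal\<lparr>elems := Collect (standardizes n p)\<rparr>"

text \<open>The letter at position \<open>p k\<close> moves to position \<open>q k\<close>: the
  sorted sequence is kept and only the permutation is exchanged.\<close>

definition rearrange :: "nat \<Rightarrow> (nat \<Rightarrow> nat) \<Rightarrow> (nat \<Rightarrow> nat) \<Rightarrow> 'a list \<Rightarrow> 'a list" where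
  "rearrange n p q w = map (\<lambda>x. w ! p (inv_into {..<n} q x)) [0..<n]"

lemma closed_subset_standardizes: "closed_subset word_crystal (Collect (standardizes n p))"
  by (auto simp: closed_subset_def intro: standardizes_e_imp standardizes_f_imp)

lemma length_rearrange [simp]: "length (rearrange n p q w) = n"
  by (simp add: rearrange_def)

lemma bij_betw_lessThan_less: "bij_betw p {..<n} {..<n::nat} \<Longrightarrow> k < n \<Longrightarrow> p k < n"
  by (auto simp: bij_betw_def)

lemma nth_rearrange:
  assumes "bij_betw q {..<n} {..<n}" "k < n"
  shows "rearrange n p q w ! q k = w ! p k"
  using assms bij_betw_lessThan_less[OF assms] by (simp add: rearrange_def bij_betw_inv_into_left)

lemma list_eq_via_bij:
  assumes p: "bij_betw p {..<n} {..<n}" and "length v = n" "length w = n"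
    and eq: "\<And>k. k < n \<Longrightarrow> v ! p k = w ! p k"
  shows "v = w"
proof (intro nth_equalityI)
  fix x assume "x < length v"
  then have "x \<in> p ` {..<n}" using p assms(2) by (simp add: bij_betw_def)
  then show "v ! x = w ! x" using eq by auto
qed (use assms in simp)

lemma rearrange_rearrange:
  assumes "bij_betw p {..<n} {..<n}" "bij_betw q {..<n} {..<n}" "length w = n"
  shows "rearrange n q p (rearrange n p q w) = w"
  using assms by (intro list_eq_via_bij[OF assms(1)]) (simp_all add: nth_rearrange)

lemma rearrange_update:
  assumes p: "bij_betw p {..<n} {..<n}" and q: "bij_betw q {..<n} {..<n}"
    and "length w = n" "k < n"
  shows "rearrange n p q (w[p k := a]) = (rearrange n p q w)[q k := a]"
proof (rule list_eq_via_bij[OF q])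
  fix l assume l: "l < n"
  have "p k = p l \<longleftrightarrow> k = l" "q k = q l \<longleftrightarrow> k = l"
    using p q l assms(4) by (auto simp: bij_betw_def inj_on_def)
  then show "rearrange n p q (w[p k := a]) ! q l = (rearrange n p q w)[q k := a] ! q l"
    using assms l by (simp add: nth_rearrange[OF q] nth_list_update bij_betw_lessThan_less)
qed simp_all

lemma mset_via_bij:
  assumes "bij_betw p {..<n} {..<n}" "length w = n"
  shows "mset (map (\<lambda>k. w ! p k) [0..<n]) = mset w"
proof -
  have "image_mset p (mset_set {..<n}) = mset_set {..<n}"
    using assms(1) by (simp add: image_mset_mset_set bij_betw_def)
  then have "image_mset ((!) w) (image_mset p (mset_set {..<n})) = image_mset ((!) w) (mset_set {..<n})"
    by simp
  moreover have "mset w = image_mset ((!) w) (mset_set {..<n})"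
    using assms(2) map_nth[of w] by (metis atLeast0LessThan mset_map mset_upt)
  ultimately show ?thesis
    by (simp add: image_mset.compositionality comp_def atLeast0LessThan)
qed

lemma standardizes_rearrange:
  assumes w: "standardizes n p w" and q: "bij_betw q {..<n} {..<n}"
    and desc: "\<And>k. Suc k < n \<Longrightarrow> descent p k = descent q k"
  shows "standardizes n q (rearrange n p q w)"
proof -
  have "compatible n (descent p) (\<lambda>k. w ! p k)" using w by (simp add: standardizes_def)
  then have "compatible n (descent q) (\<lambda>k. rearrange n p q w ! q k)"
    using desc compatible_cong[of n "\<lambda>k. rearrange n p q w ! q k" "\<lambda>k. w ! p k" "descent q" "descent p"]
    by (simp add: nth_rearrange[OF q])
  with q show ?thesis by (simp add: standardizes_def)
qed

text \<open>By \<open>standardizes_f_iff\<close> the arrows depend only on the sorted sequence and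
  the descents, which \<open>p\<close> and \<open>q\<close> share. The inverse is the same
  construction with \<open>p\<close> and \<open>q\<close> exchanged.\<close>

lemma crystal_iso_rearrange:
  assumes p: "bij_betw p {..<n} {..<n}" and q: "bij_betw q {..<n} {..<n}"
    and desc: "\<And>k. Suc k < n \<Longrightarrow> descent p k = descent q k"
  shows "crystal_iso (words_with n p) (words_with n q) (rearrange n p q)"
proof -
  let ?X = "Collect (standardizes n p)" and ?Y = "Collect (standardizes n q)"
  let ?r = "rearrange n p q" and ?s = "rearrange n q p"
  have rY: "standardizes n q (?r w)" if "standardizes n p w" for w
    using standardizes_rearrange[OF that q desc] .
  have sX: "standardizes n p (?s w)" if "standardizes n q w" for w
    using standardizes_rearrange[OF that p] desc by simp
  have len: "length w = n" if "standardizes n p w \<or> standardizes n q w" for w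
    using that by (auto simp: standardizes_def)
  have sr: "?s (?r w) = w" if "length w = n" for w
    using rearrange_rearrange[OF p q that] .
  have rs: "?r (?s w) = w" if "length w = n" for w
    using rearrange_rearrange[OF q p that] .
  have bij: "bij_betw ?r ?X ?Y"
    by (rule bij_betw_byWitness[where f' = ?s]) (auto simp: sr rs len rY sX)
  have f_imp: "word_op letter_f i (?r v) = Some (?r w)"
    if v: "standardizes n p v" and w: "standardizes n p w" and f: "word_op letter_f i v = Some w" for i v w
  proof -
    obtain k where k: "k < n" "v ! p k = i" "w = v[p k := next_half i]"
      using f by (auto simp: standardizes_f_iff[OF v])
    have "?r w = (?r v)[q k := next_half i]"
      using k rearrange_update[OF p q, of v k] len[of v] v by simp
    with k show ?thesis
      using rY[OF w] by (auto simp: standardizes_f_iff[OF rY[OF v]] nth_rearrange[OF q])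
  qed
  have f_imp': "word_op letter_f i (?s v) = Some (?s w)"
    if v: "standardizes n q v" and w: "standardizes n q w" and f: "word_op letter_f i v = Some w" for i v w
  proof -
    obtain k where k: "k < n" "v ! q k = i" "w = v[q k := next_half i]"
      using f by (auto simp: standardizes_f_iff[OF v])
    have "?s w = (?s v)[p k := next_half i]"
      using k rearrange_update[OF q p, of v k] len[of v] v by simp
    with k show ?thesis
      using sX[OF w] by (auto simp: standardizes_f_iff[OF sX[OF v]] nth_rearrange[OF p])
  qed
  have f: "word_op letter_f i v = Some w \<longleftrightarrow> word_op letter_f i (?r v) = Some (?r w)"
    if "standardizes n p v" "standardizes n p w" for i v w
    using f_imp[OF that] f_imp'[OF rY[OF that(1)] rY[OF that(2)]]
      sr[OF len[OF disjI1[OF that(1)]]] sr[OF len[OF disjI1[OF that(2)]]] by metis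
  \<comment> \<open>The arrow equivalence speaks of pairs inside the two sets. To transfer
    undefinedness, closure under the operators is used: a defined result lies in the set, so its
    arrow can be transported.\<close>
  have phi: "word_op letter_f i (?r v) = None \<longleftrightarrow> word_op letter_f i v = None"
    if v: "standardizes n p v" for i v
  proof
    assume "word_op letter_f i (?r v) = None"
    then show "word_op letter_f i v = None"
      using f[OF v] standardizes_f_imp[OF v] by (metis not_None_eq)
  next
    assume "word_op letter_f i v = None"
    then show "word_op letter_f i (?r v) = None"
      using f_imp'[OF rY[OF v]] standardizes_f_imp[OF rY[OF v]] sr len v by (metis not_None_eq)
  qed
  have eps: "word_op letter_e i (?r v) = None \<longleftrightarrow> word_op letter_e i v = None"
    if v: "standardizes n p v" for i v
  proof
    assume "word_op letter_e i (?r v) = None"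
    then show "word_op letter_e i v = None"
      using f[OF _ v] standardizes_e_imp[OF v] by (metis not_None_eq word_f_iff_e)
  next
    assume *: "word_op letter_e i v = None"
    show "word_op letter_e i (?r v) = None"
    proof (rule ccontr)
      assume "word_op letter_e i (?r v) \<noteq> None"
      then obtain u where u: "word_op letter_e i (?r v) = Some u" by blast
      have "word_op letter_f i (?s u) = Some (?s (?r v))"
        using f_imp'[OF standardizes_e_imp[OF rY[OF v] u] rY[OF v]] u by (simp add: word_f_iff_e)
      with * show False using sr[OF len[OF disjI1[OF v]]] by (simp add: word_f_iff_e)
    qed
  qed
  have wt: "wt word_crystal (?r v) = wt word_crystal v" if v: "standardizes n p v" for v
  proof -
    have "map (\<lambda>k. ?r v ! q k) [0..<n] = map (\<lambda>k. v ! p k) [0..<n]"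
      by (simp add: nth_rearrange[OF q])
    then have "mset (?r v) = mset v"
      using mset_via_bij[OF p len[OF disjI1[OF v]]] mset_via_bij[OF q, of "?r v"] by (metis length_rearrange)
    then show ?thesis by (simp add: wt_word_eq_iff)
  qed
  show ?thesis
    unfolding crystal_iso_def words_with_def using bij
    by (intro conjI allI ballI) (simp_all add: f[symmetric] phi eps wt)
qed

section \<open>Recovering the sorted sequence and the descents from the crystal\<close>

lemma sequence_eq_of_mset_eq:
  assumes v: "standardizes m p v" and w: "standardizes n q w" and eq: "mset v = mset w"
  shows "m = n" "k < n \<Longrightarrow> v ! p k = w ! q k"
proof -
  show mn: "m = n" using v w mset_eq_length[OF eq] by (simp add: standardizes_def)
  have sort: "sort u = map (\<lambda>k. u ! r k) [0..<n]" if u: "standardizes n r u" for u r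
  proof (intro properties_for_sort)
    show "mset (map (\<lambda>k. u ! r k) [0..<n]) = mset u"
      using u by (intro mset_via_bij) (auto simp: standardizes_def)
    show "sorted (map (\<lambda>k. u ! r k) [0..<n])"
      using u by (auto simp: sorted_iff_nth_mono standardizes_def intro: compatible_mono)
  qed
  have "sort v = sort w"
    using eq by (metis properties_for_sort mset_sort sorted_sort)
  then have "map (\<lambda>k. v ! p k) [0..<n] = map (\<lambda>k. w ! q k) [0..<n]"
    using sort v w mn by simp
  then show "v ! p k = w ! q k" if "k < n"
    using that by simp
qed

text \<open>Raising place \<open>k\<close> widens the gap on its left, so the only possible
  obstruction is a forbidden tie with place \<open>Suc k\<close>, which \<open>tie\<close>
  excludes.\<close>

lemma standardizes_raise:
  assumes v: "standardizes n r v" and k: "Suc k < n" and i: "v ! r k = i" and less: "i < v ! r (Suc k)"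
    and tie: "next_half i = v ! r (Suc k) \<Longrightarrow> is_integer (next_half i) \<longleftrightarrow> descent r k"
  shows "word_op letter_f i v = Some (v[r k := next_half i])"
    "standardizes n r (v[r k := next_half i])"
    "v[r k := next_half i] ! r k = next_half i" "v[r k := next_half i] ! r (Suc k) = v ! r (Suc k)"
proof -
  have "compatible n (descent r) ((\<lambda>k. v ! r k)(k := next_half i))"
    unfolding compatible_def
  proof (intro allI impI)
    fix m assume m: "Suc m < n"
    have old: "v ! r m < v ! r (Suc m) \<or> v ! r m = v ! r (Suc m) \<and> is_integer (v ! r m) = descent r m"
      using v m by (simp add: standardizes_def compatible_def)
    consider "m = k" | "Suc m = k" | "m \<noteq> k" "Suc m \<noteq> k" by blast
    then show "((\<lambda>k. v ! r k)(k := next_half i)) m < ((\<lambda>k. v ! r k)(k := next_half i)) (Suc m) \<or>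
      ((\<lambda>k. v ! r k)(k := next_half i)) m = ((\<lambda>k. v ! r k)(k := next_half i)) (Suc m) \<and>
      is_integer (((\<lambda>k. v ! r k)(k := next_half i)) m) = descent r m"
    proof cases
      case 1
      have "next_half i \<le> v ! r (Suc k)" using less by (simp add: next_le_iff)
      with tie 1 show ?thesis
        by (cases "next_half i = v ! r (Suc k)") (simp_all add: order_le_less del: is_integer_next)
    next
      case 2
      then have "v ! r m \<le> i" using old i by auto
      with 2 show ?thesis by (auto simp: less_next_iff)
    next
      case 3
      with old show ?thesis by simp
    qed
  qed
  then show st: "standardizes n r (v[r k := next_half i])"
    using standardizes_update[OF v] k by simp
  then show "word_op letter_f i v = Some (v[r k := next_half i])"
    unfolding standardizes_f_iff[OF v] using i k by (intro exI[of _ k]) simp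
  show "v[r k := next_half i] ! r k = next_half i"
    "v[r k := next_half i] ! r (Suc k) = v ! r (Suc k)"
    using k standardizes_less[OF v, of k] standardizes_eq_iff[OF v, of k "Suc k"] by auto
qed

text \<open>The descents are read off by raising the \<open>k\<close>-th smallest letter towards the next one: whether
  it can be made equal to it depends exactly on the parity of that letter and on the descent at \<open>k\<close>.\<close>

lemma descent_eq_of_crystal_iso:
  assumes iso: "crystal_iso (component word_crystal w0) (component word_crystal u0) \<psi>"
    and w: "w \<in> elems (component word_crystal w0)"
    and p: "standardizes n p w" and q: "standardizes n q (\<psi> w)" and k: "Suc k < n"
  shows "descent p k \<longleftrightarrow> descent q k"
  using w p q
\<comment> \<open>The gap, in half-steps, between the two letters. The word has to vary, since each
  raise moves it to another word of the same component; \<open>p\<close> and \<open>q\<close> stay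
  fixed.\<close>
proof (induction "half_index (w ! p (Suc k)) - half_index (w ! p k)" arbitrary: w rule: less_induct)
  case less
  let ?K = "elems (component word_crystal w0)"
  note w = less.prems(1) and p = less.prems(2) and q = less.prems(3)
  have f: "word_op letter_f i v = Some v' \<longleftrightarrow> word_op letter_f i (\<psi> v) = Some (\<psi> v')"
    if "v \<in> ?K" "v' \<in> ?K" for i v v'
    using iso that unfolding crystal_iso_def component_simps(6) word_crystal_simps(2) by blast
  have K_f: "v' \<in> ?K" if "v \<in> ?K" "word_op letter_f i v = Some v'" for i v v'
    using that by (auto simp: arrows_def intro: rtrancl_into_rtrancl)
  have phi: "word_op letter_f i (\<psi> v) = None \<longleftrightarrow> word_op letter_f i v = None" if "v \<in> ?K" for i v
  proof -
    have "phi word_crystal i (\<psi> v) = phi word_crystal i v"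
      using iso that unfolding crystal_iso_def component_simps(4) by blast
    then show ?thesis by (simp split: if_splits)
  qed
  have same: "v ! p l = \<psi> v ! q l"
    if "v \<in> ?K" "standardizes n p v" "standardizes n q (\<psi> v)" "l < n" for v l
  proof -
    have "wt word_crystal (\<psi> v) = wt word_crystal v"
      using iso that(1) unfolding crystal_iso_def component_simps(2) by blast
    then show ?thesis using sequence_eq_of_mset_eq[OF that(2,3)] that(4) by (simp add: wt_word_eq_iff)
  qed
  have tie: "is_integer (v ! r k) \<longleftrightarrow> descent r k"
    if "standardizes n r v" "v ! r k = v ! r (Suc k)" for v r
    using that k by (auto simp: standardizes_def compatible_def)
  let ?i = "w ! p k"
  have le: "?i \<le> w ! p (Suc k)"
    using p k compatible_mono[of n "descent p" "\<lambda>k. w ! p k" k "Suc k"]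
    by (simp add: standardizes_def)
  have sameq: "\<psi> w ! q k = ?i" "\<psi> w ! q (Suc k) = w ! p (Suc k)"
    using same[OF w p q] k by auto
  show ?case
  proof (cases "?i = w ! p (Suc k)")
    case True
    then show ?thesis using tie[OF p] tie[OF q] sameq by simp
  next
    case False
    with le have lt: "?i < w ! p (Suc k)" by simp
    let ?w = "w[p k := next_half ?i]" and ?u = "(\<psi> w)[q k := next_half ?i]"
    show ?thesis
    proof (cases "next_half ?i = w ! p (Suc k) \<and> is_integer (next_half ?i) \<noteq> descent p k")
      case False
      then have "next_half ?i = w ! p (Suc k) \<Longrightarrow> is_integer (next_half ?i) \<longleftrightarrow> descent p k"
        by blast
      note r = standardizes_raise[OF p k refl lt this]
      have wK: "?w \<in> ?K" using K_f[OF w r(1)] .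
      have "word_op letter_f ?i (\<psi> w) = Some (\<psi> ?w)"
        using f[OF w wK] r(1) by simp
      then have "standardizes n q (\<psi> ?w)" using standardizes_f_imp[OF q] by blast
      moreover have "half_index (?w ! p (Suc k)) - half_index (?w ! p k) <
          half_index (w ! p (Suc k)) - half_index (w ! p k)"
        using r lt by (simp add: half_index_less)
      ultimately show ?thesis using less.hyps[OF _ wK r(2)] by blast
    next
      case True
      show ?thesis
      \<comment> \<open>For \<open>p\<close> the raise would create a forbidden tie. If
        \<open>q\<close> had the other descent status, the tie would be allowed there and
        \<open>\<psi> w\<close> could be raised. Preservation of \<open>phi\<close> then makes
        \<open>w\<close> raisable by the same operator, and the weights force its result to contain
        that forbidden tie.\<close>
      proof (rule ccontr)
        assume "descent p k \<noteq> descent q k"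
        with True have "is_integer (next_half ?i) \<longleftrightarrow> descent q k" by blast
        moreover have "?i < \<psi> w ! q (Suc k)" using lt sameq(2) by simp
        ultimately have r: "word_op letter_f ?i (\<psi> w) = Some ?u" "standardizes n q ?u"
          "?u ! q k = next_half ?i" "?u ! q (Suc k) = w ! p (Suc k)"
          using standardizes_raise[OF q k sameq(1)] unfolding sameq(2) by blast+
        then obtain w' where w': "word_op letter_f ?i w = Some w'"
          using phi[OF w, of ?i] by auto
        have w'K: "w' \<in> ?K" using K_f[OF w w'] .
        have "\<psi> w' = ?u" using f[OF w w'K] w' r(1) by auto
        moreover have pw': "standardizes n p w'" using standardizes_f_imp[OF p w'] .
        ultimately have "w' ! p k = next_half ?i" "w' ! p (Suc k) = next_half ?i"
          using same[OF w'K, of k] same[OF w'K, of "Suc k"] r True k by simp_all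
        with tie[OF pw'] True show False by metis
      qed
    qed
  qed
qed


subsection \<open>Ribbons\<close>

text \<open>The number of the first node of row \<open>i\<close>, counted along the ribbon; past the
  last row \<open>take\<close> makes it the total size.\<close>

definition offset :: "nat list \<Rightarrow> nat \<Rightarrow> nat" where
  "offset \<alpha> i = sum_list (take i \<alpha>)"

definition in_row :: "nat list \<Rightarrow> nat \<Rightarrow> nat \<Rightarrow> bool" where
  "in_row \<alpha> i k \<longleftrightarrow> i < length \<alpha> \<and> offset \<alpha> i \<le> k \<and> k < offset \<alpha> (Suc i)"

definition row_of :: "nat list \<Rightarrow> nat \<Rightarrow> nat" where
  "row_of \<alpha> k = (THE i. in_row \<alpha> i k)"

text \<open>Nodes are numbered from \<open>0\<close> along the ribbon, so that node \<open>(i, j)\<close> has number \<open>i + j\<close>.\<close>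

definition same_row :: "nat list \<Rightarrow> nat \<Rightarrow> bool" where
  "same_row \<alpha> k \<longleftrightarrow> (\<forall>i. offset \<alpha> i \<noteq> Suc k)"

definition entry :: "nat list \<Rightarrow> filling \<Rightarrow> nat \<Rightarrow> half_pos" where
  "entry \<alpha> T k = the (T (row_of \<alpha> k, k - row_of \<alpha> k))"

definition reading_order :: "nat list \<Rightarrow> nat list" where
  "reading_order \<alpha> = concat (map (\<lambda>i. rev [offset \<alpha> i..<offset \<alpha> (Suc i)]) [0..<length \<alpha>])"

lemma offset_0 [simp]: "offset \<alpha> 0 = 0"
  by (simp add: offset_def)

lemma offset_Suc: "i < length \<alpha> \<Longrightarrow> offset \<alpha> (Suc i) = offset \<alpha> i + \<alpha> ! i"
  by (simp add: offset_def take_Suc_conv_app_nth)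

lemma offset_Cons [simp]: "offset (a # \<alpha>) (Suc i) = a + offset \<alpha> i"
  by (simp add: offset_def)

lemma offset_length: "length \<alpha> \<le> i \<Longrightarrow> offset \<alpha> i = sum_list \<alpha>"
  by (simp add: offset_def)

lemma offset_mono: "i \<le> j \<Longrightarrow> offset \<alpha> i \<le> offset \<alpha> j"
proof (induction j rule: dec_induct)
  case (step j)
  then show ?case
    by (cases "j < length \<alpha>") (simp_all add: offset_Suc offset_length)
qed simp

lemma offset_le: "offset \<alpha> i \<le> sum_list \<alpha>"
  using offset_mono[of i "max i (length \<alpha>)" \<alpha>] by (simp add: offset_length)

text \<open>Consecutive rows overlap in one column, so the starting column falls one further behind
  with every row. Positive parts keep the subtraction in \<open>row_start\<close> from
  truncating.\<close>

lemma offset_row_start: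
  assumes "composition \<alpha>"
  shows "i \<le> length \<alpha> \<Longrightarrow> offset \<alpha> i = row_start \<alpha> i + i"
proof (induction i)
  case (Suc i)
  then have "\<alpha> ! i > 0" using assms by (simp add: composition_def)
  with Suc show ?case by (simp add: offset_Suc row_start_def)
qed (simp add: row_start_def)

lemma in_row_unique: "in_row \<alpha> i k \<Longrightarrow> in_row \<alpha> i' k \<Longrightarrow> i = i'"
  using offset_mono[of "Suc i" i' \<alpha>] offset_mono[of "Suc i'" i \<alpha>]
  by (cases i i' rule: linorder_cases) (auto simp: in_row_def)

lemma row_of_eq: "in_row \<alpha> i k \<Longrightarrow> row_of \<alpha> k = i"
  unfolding row_of_def using in_row_unique by blast

lemma in_row_less: "in_row \<alpha> i k \<Longrightarrow> k < sum_list \<alpha>"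
  using offset_le[of \<alpha> "Suc i"] by (simp add: in_row_def)

lemma in_row_row_of:
  assumes "k < sum_list \<alpha>"
  shows "in_row \<alpha> (row_of \<alpha> k) k"
proof -
  have *: "k < offset \<alpha> (length \<alpha>)" using assms by (simp add: offset_length)
  define j where "j = (LEAST i. k < offset \<alpha> i)"
  have j: "k < offset \<alpha> j" "j \<le> length \<alpha>"
    unfolding j_def using * by (rule LeastI, rule Least_le)
  then obtain i where i: "j = Suc i" by (cases j) auto
  have "\<not> k < offset \<alpha> i" using not_less_Least[of i "\<lambda>i. k < offset \<alpha> i"] i by (simp add: j_def)
  with i j have "in_row \<alpha> i k" by (simp add: in_row_def)
  then show ?thesis using row_of_eq by blast
qed

lemma ribbon_iff_in_row:
  assumes "composition \<alpha>"
  shows "(i, j) \<in> ribbon \<alpha> \<longleftrightarrow> in_row \<alpha> i (i + j)"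
  using offset_row_start[OF assms, of i] offset_Suc[of i \<alpha>] by (auto simp: ribbon_def in_row_def)

lemma ribbon_iff:
  assumes "composition \<alpha>"
  shows "(i, j) \<in> ribbon \<alpha> \<longleftrightarrow> i + j < sum_list \<alpha> \<and> row_of \<alpha> (i + j) = i"
  using ribbon_iff_in_row[OF assms] in_row_less in_row_row_of row_of_eq by metis

lemma in_row_le: "composition \<alpha> \<Longrightarrow> in_row \<alpha> i k \<Longrightarrow> i \<le> k"
  using offset_row_start[of \<alpha> i] by (auto simp: in_row_def)

text \<open>If node \<open>k\<close> ends its row, the next row is nonempty because parts are
  positive, and node \<open>Suc k\<close> opens it.\<close>

lemma in_row_Suc:
  assumes "composition \<alpha>" and i: "in_row \<alpha> i k" and k: "Suc k < sum_list \<alpha>"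
  shows "if same_row \<alpha> k then in_row \<alpha> i (Suc k)
    else in_row \<alpha> (Suc i) (Suc k) \<and> offset \<alpha> (Suc i) = Suc k"
proof (cases "Suc k = offset \<alpha> (Suc i)")
  case True
  then have "Suc i < length \<alpha>"
    using k offset_length[of \<alpha> "Suc i"] by (metis less_irrefl not_le)
  moreover from this have "\<alpha> ! Suc i > 0" using assms(1) by (simp add: composition_def)
  ultimately have "in_row \<alpha> (Suc i) (Suc k)" using True by (simp add: in_row_def offset_Suc)
  moreover have "\<not> same_row \<alpha> k" using True unfolding same_row_def by metis
  ultimately show ?thesis using True by simp
next
  case False
  with i have less: "in_row \<alpha> i (Suc k)" by (auto simp: in_row_def)
  have "offset \<alpha> i' \<noteq> Suc k" for i'
  proof (cases "i' \<le> i")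
    case True
    with i offset_mono[OF this, of \<alpha>] show ?thesis by (simp add: in_row_def)
  next
    case False
    then have "offset \<alpha> (Suc i) \<le> offset \<alpha> i'" by (intro offset_mono) simp
    with less show ?thesis by (simp add: in_row_def)
  qed
  with less show ?thesis by (simp add: same_row_def)
qed

lemma row_of_0: "composition \<alpha> \<Longrightarrow> 0 < sum_list \<alpha> \<Longrightarrow> row_of \<alpha> 0 = 0"
  using in_row_le in_row_row_of by blast

lemma row_of_Suc:
  assumes "composition \<alpha>" "Suc k < sum_list \<alpha>"
  shows "row_of \<alpha> (Suc k) = (if same_row \<alpha> k then row_of \<alpha> k else Suc (row_of \<alpha> k))"
  using in_row_Suc[OF assms(1) in_row_row_of assms(2)] assms(2) row_of_eq by (metis Suc_lessD)

text \<open>The row number starts at \<open>0\<close> and grows by one exactly at the row breaks, so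
  the breaks determine the diagram.\<close>

lemma row_of_cong:
  assumes "composition \<alpha>" "composition \<beta>" "sum_list \<alpha> = n" "sum_list \<beta> = n"
    and "\<And>k. Suc k < n \<Longrightarrow> same_row \<alpha> k = same_row \<beta> k"
  shows "k < n \<Longrightarrow> row_of \<alpha> k = row_of \<beta> k"
proof (induction k)
  case 0
  then show ?case using assms by (simp add: row_of_0)
next
  case (Suc k)
  then show ?case using assms by (simp add: row_of_Suc)
qed

lemma ex_composition:
  "\<exists>\<alpha>. composition \<alpha> \<and> sum_list \<alpha> = n \<and> (\<forall>k. Suc k < n \<longrightarrow> same_row \<alpha> k = D k)"
proof (induction n arbitrary: D)
  case 0
  show ?case by (intro exI[of _ "[]"]) (simp add: composition_def)
next
  case (Suc n)
  obtain \<alpha> where \<alpha>: "composition \<alpha>" "sum_list \<alpha> = n" "\<And>k. Suc k < n \<Longrightarrow> same_row \<alpha> k = D (Suc k)"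
    using Suc.IH[of "\<lambda>k. D (Suc k)"] by blast
  show ?case
  \<comment> \<open>A node is put in front of the ribbon: it lengthens the first row if
    \<open>D 0\<close> holds and otherwise forms a row of its own. For \<open>n = 0\<close> there is
    no row to lengthen.\<close>
  proof (cases "n > 0 \<and> D 0")
    case False
    have "same_row (1 # \<alpha>) k = D k" if k: "Suc k < Suc n" for k
    proof (cases k)
      case 0
      have "offset (1 # \<alpha>) (Suc 0) = Suc 0" by simp
      then have "\<not> same_row (1 # \<alpha>) 0" unfolding same_row_def by blast
      with False k 0 show ?thesis by simp
    next
      case (Suc m)
      have "same_row (1 # \<alpha>) k \<longleftrightarrow> same_row \<alpha> m"
        unfolding same_row_def Suc by (metis (no_types) Suc_inject offset_0 offset_Cons
          plus_1_eq_Suc not0_implies_Suc nat.distinct(1))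
      with \<alpha>(3) k Suc show ?thesis by simp
    qed
    with \<alpha> show ?thesis by (intro exI[of _ "1 # \<alpha>"]) (auto simp: composition_def)
  next
    case True
    with \<alpha> obtain a \<beta> where \<beta>: "\<alpha> = a # \<beta>" by (cases \<alpha>) auto
    have a: "a > 0" using \<alpha>(1) \<beta> by (simp add: composition_def)
    have same: "same_row (Suc a # \<beta>) k \<longleftrightarrow> (\<forall>i. Suc (a + offset \<beta> i) \<noteq> Suc k)" for k
      unfolding same_row_def by (metis add_Suc nat.distinct(1) not0_implies_Suc offset_0 offset_Cons)
    have "same_row (Suc a # \<beta>) k = D k" if k: "Suc k < Suc n" for k
    proof (cases k)
      case 0
      with a True same[of k] show ?thesis by simp
    next
      case (Suc m)
      have "same_row (Suc a # \<beta>) k \<longleftrightarrow> same_row \<alpha> m"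
        unfolding same unfolding same_row_def Suc \<beta>
        by (metis nat.distinct(1) not0_implies_Suc offset_0 offset_Cons nat.inject)
      with \<alpha>(3) k Suc show ?thesis by simp
    qed
    with \<alpha> \<beta> show ?thesis by (intro exI[of _ "Suc a # \<beta>"]) (auto simp: composition_def)
  qed
qed


subsection \<open>The reading order\<close>

lemma length_reading_order_take:
  "m \<le> length \<alpha> \<Longrightarrow>
     length (concat (map (\<lambda>i. rev [offset \<alpha> i..<offset \<alpha> (Suc i)]) [0..<m])) = offset \<alpha> m"
  by (induction m) (simp_all add: offset_Suc)

lemma length_reading_order [simp]: "length (reading_order \<alpha>) = sum_list \<alpha>"
  by (simp only: reading_order_def length_reading_order_take[OF order_refl] offset_length[OF order_refl])

lemma nth_rev_upt: "a \<le> k \<Longrightarrow> k < b \<Longrightarrow> rev [a..<b] ! (k - a) = a + b - Suc k"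
  by (subst rev_nth) auto

lemma nth_reading_order:
  assumes "in_row \<alpha> i k"
  shows "reading_order \<alpha> ! k = offset \<alpha> i + offset \<alpha> (Suc i) - Suc k"
proof -
  let ?R = "\<lambda>m. concat (map (\<lambda>i. rev [offset \<alpha> i..<offset \<alpha> (Suc i)]) [0..<m])"
  have "?R m ! k = offset \<alpha> i + offset \<alpha> (Suc i) - Suc k" if "Suc i \<le> m" "m \<le> length \<alpha>" for m
    using that
  proof (induction m rule: dec_induct)
    case base
    then show ?case
      using assms length_reading_order_take[of i \<alpha>]
      by (simp add: nth_append nth_rev_upt in_row_def)
  next
    case (step m)
    have "k < offset \<alpha> m"
      using assms offset_mono[OF step.hyps(1), of \<alpha>] by (simp add: in_row_def)
    with step show ?case
      using length_reading_order_take[of m \<alpha>] by (simp add: nth_append)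
  qed
  then show ?thesis using assms by (simp add: reading_order_def in_row_def)
qed

lemma in_row_reading_order: "in_row \<alpha> i k \<Longrightarrow> in_row \<alpha> i (reading_order \<alpha> ! k)"
  by (auto simp: nth_reading_order in_row_def)

text \<open>Each row is reversed in place. Hence one list serves both as the nodes in reading order
  and as the map from a node to its position in the reading word, which is what
  \<open>standardizes\<close> asks for.\<close>

lemma reading_order_involution:
  assumes "k < sum_list \<alpha>"
  shows "reading_order \<alpha> ! (reading_order \<alpha> ! k) = k"
proof -
  note i = in_row_row_of[OF assms]
  show ?thesis
    using i by (subst nth_reading_order[OF in_row_reading_order[OF i]], subst nth_reading_order[OF i])
      (auto simp: in_row_def)
qed

lemma reading_order_less: "k < sum_list \<alpha> \<Longrightarrow> reading_order \<alpha> ! k < sum_list \<alpha>"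
  using in_row_less in_row_reading_order in_row_row_of by blast

lemma bij_betw_reading_order:
  "n = sum_list \<alpha> \<Longrightarrow> bij_betw ((!) (reading_order \<alpha>)) {..<n} {..<n}"
  by (rule bij_betw_byWitness[where f' = "(!) (reading_order \<alpha>)"])
    (auto simp: reading_order_involution reading_order_less)

text \<open>Reversal makes positions fall within a row, while the blocks of positions of successive
  rows keep their order.\<close>

lemma descent_reading_order:
  assumes \<alpha>: "composition \<alpha>" and k: "Suc k < sum_list \<alpha>"
  shows "descent ((!) (reading_order \<alpha>)) k \<longleftrightarrow> same_row \<alpha> k"
proof -
  have i: "in_row \<alpha> (row_of \<alpha> k) k" using k by (intro in_row_row_of) simp
  note S = in_row_Suc[OF \<alpha> i k]
  show ?thesis
  proof (cases "same_row \<alpha> k")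
    case True
    with S have *: "in_row \<alpha> (row_of \<alpha> k) (Suc k)" by simp
    show ?thesis
      using True i * nth_reading_order[OF i] nth_reading_order[OF *]
      by (auto simp: descent_def in_row_def)
  next
    case False
    with S have *: "in_row \<alpha> (Suc (row_of \<alpha> k)) (Suc k)" by simp
    show ?thesis
      using False in_row_reading_order[OF i] in_row_reading_order[OF *]
      by (auto simp: descent_def in_row_def)
  qed
qed

lemma reading_word_eq:
  assumes "composition \<alpha>"
  shows "reading_word \<alpha> T = map (entry \<alpha> T) (reading_order \<alpha>)"
proof -
  have "map (\<lambda>j. the (T (i, j))) [row_start \<alpha> i ..< row_start \<alpha> i + \<alpha> ! i]
      = map (entry \<alpha> T) [offset \<alpha> i..<offset \<alpha> (Suc i)]" if i: "i < length \<alpha>" for i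
  proof (rule nth_equalityI)
    fix t assume "t < length (map (\<lambda>j. the (T (i, j))) [row_start \<alpha> i ..< row_start \<alpha> i + \<alpha> ! i])"
    then have t: "t < \<alpha> ! i" by simp
    then have "in_row \<alpha> i (offset \<alpha> i + t)" using i by (simp add: in_row_def offset_Suc)
    then have "entry \<alpha> T (offset \<alpha> i + t) = the (T (i, row_start \<alpha> i + t))"
      using offset_row_start[OF assms, of i] i by (simp add: entry_def row_of_eq)
    with t i show "map (\<lambda>j. the (T (i, j))) [row_start \<alpha> i ..< row_start \<alpha> i + \<alpha> ! i] ! t
        = map (entry \<alpha> T) [offset \<alpha> i..<offset \<alpha> (Suc i)] ! t"
      by (simp add: offset_Suc)
  qed (use i in \<open>simp add: offset_Suc\<close>)
  then show ?thesis
    unfolding reading_word_def reading_order_def map_concat map_map comp_def rev_map[symmetric]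
    by (intro arg_cong[where f = concat] map_cong[OF refl] arg_cong[where f = rev]) auto
qed


subsection \<open>Quasi-ribbon tableaux as words\<close>

lemma filling_entry:
  assumes "composition \<alpha>" "dom T = ribbon \<alpha>"
  shows "T (i, j) = (if (i, j) \<in> ribbon \<alpha> then Some (entry \<alpha> T (i + j)) else None)"
proof (cases "(i, j) \<in> ribbon \<alpha>")
  case True
  then have "(i, j) \<in> dom T" using assms(2) by simp
  with True show ?thesis
    using ribbon_iff[OF assms(1), of i j] by (auto simp: entry_def)
next
  case False
  then have "(i, j) \<notin> dom T" using assms(2) by simp
  with False show ?thesis by (simp add: domIff)
qed

text \<open>The definition compares all pairs in a row or column, \<open>compatible\<close> only
  neighbours along the ribbon. To pass from neighbours to pairs, equal entries force a constant
  stretch, and its first step decides the parity.\<close>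

lemma quasi_ribbon_tableaux_iff:
  assumes \<alpha>: "composition \<alpha>"
  shows "T \<in> quasi_ribbon_tableaux \<alpha> \<longleftrightarrow>
    dom T = ribbon \<alpha> \<and> compatible (sum_list \<alpha>) (same_row \<alpha>) (entry \<alpha> T)"
proof (cases "dom T = ribbon \<alpha>")
  case False
  then show ?thesis by (simp add: quasi_ribbon_tableaux_def)
next
  case dom: True
  let ?a = "entry \<alpha> T" and ?n = "sum_list \<alpha>"
  have T: "T (i, j) = Some x \<longleftrightarrow> in_row \<alpha> i (i + j) \<and> x = ?a (i + j)" for i j x
    using filling_entry[OF \<alpha> dom, of i j] ribbon_iff_in_row[OF \<alpha>, of i j] by auto
  show ?thesis
  proof
    assume "T \<in> quasi_ribbon_tableaux \<alpha>"
    then have row: "a \<le> b \<and> (\<not> is_integer a \<and> \<not> is_integer b \<longrightarrow> a < b)"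
        if "j < j'" "T (i, j) = Some a" "T (i, j') = Some b" for i j j' a b
      using that unfolding quasi_ribbon_tableaux_def by blast
    from \<open>T \<in> quasi_ribbon_tableaux \<alpha>\<close>
    have column: "a \<le> b \<and> (is_integer a \<and> is_integer b \<longrightarrow> a < b)"
        if "i < i'" "T (i, j) = Some a" "T (i', j) = Some b" for i i' j a b
      using that unfolding quasi_ribbon_tableaux_def by blast
    have "?a k < ?a (Suc k) \<or> ?a k = ?a (Suc k) \<and> (is_integer (?a k) \<longleftrightarrow> same_row \<alpha> k)"
      if k: "Suc k < ?n" for k
    proof -
      define i where "i = row_of \<alpha> k"
      have i: "in_row \<alpha> i k" unfolding i_def using k by (intro in_row_row_of) simp
      note S = in_row_Suc[OF \<alpha> i k]
      have ik: "i + (k - i) = k" "i + (Suc k - i) = Suc k" using in_row_le[OF \<alpha> i] by auto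
      show ?thesis
      proof (cases "same_row \<alpha> k")
        case True
        with S i ik have "T (i, k - i) = Some (?a k)" "T (i, Suc k - i) = Some (?a (Suc k))"
          by (auto simp: T)
        moreover have "k - i < Suc k - i" using in_row_le[OF \<alpha> i] by simp
        ultimately show ?thesis using row[of "k - i" "Suc k - i" i] True by fastforce
      next
        case False
        with S i ik have "T (i, k - i) = Some (?a k)" "T (Suc i, k - i) = Some (?a (Suc k))"
          by (auto simp: T)
        then show ?thesis using column[of i "Suc i" "k - i"] False by fastforce
      qed
    qed
    with dom show "dom T = ribbon \<alpha> \<and> compatible ?n (same_row \<alpha>) ?a"
      by (simp add: compatible_def)
  next
    assume "dom T = ribbon \<alpha> \<and> compatible ?n (same_row \<alpha>) ?a"
    then have c: "compatible ?n (same_row \<alpha>) ?a" by simp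
    have row: "a \<le> b \<and> (\<not> is_integer a \<and> \<not> is_integer b \<longrightarrow> a < b)"
      if "j < j'" "T (i, j) = Some a" "T (i, j') = Some b" for i j j' a b
    proof -
      have r: "in_row \<alpha> i (i + j)" "in_row \<alpha> i (i + j')" and ab: "a = ?a (i + j)" "b = ?a (i + j')"
        using that by (auto simp: T)
      have "a \<le> b" using compatible_mono[OF c] in_row_less[OF r(2)] that(1) ab by simp
      moreover have "is_integer a" if "a = b"
      proof -
        have "is_integer (?a (i + j)) \<longleftrightarrow> same_row \<alpha> (i + j)"
          using that in_row_less[OF r(2)] \<open>j < j'\<close> ab
          by (intro compatible_constant(2)[OF c, of _ "i + j'"]) auto
        moreover have "in_row \<alpha> i (Suc (i + j))" using r \<open>j < j'\<close> by (auto simp: in_row_def)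
        then have "same_row \<alpha> (i + j)"
          using in_row_Suc[OF \<alpha> r(1) in_row_less] in_row_unique by (metis n_not_Suc_n)
        ultimately show ?thesis using ab by simp
      qed
      ultimately show ?thesis by (cases "a = b") auto
    qed
    have column: "a \<le> b \<and> (is_integer a \<and> is_integer b \<longrightarrow> a < b)"
      if "i < i'" "T (i, j) = Some a" "T (i', j) = Some b" for i i' j a b
    proof -
      have r: "in_row \<alpha> i (i + j)" "in_row \<alpha> i' (i' + j)" and ab: "a = ?a (i + j)" "b = ?a (i' + j)"
        using that by (auto simp: T)
      have "a \<le> b" using compatible_mono[OF c] in_row_less[OF r(2)] that(1) ab by simp
      moreover have "\<not> is_integer a" if "a = b"
      proof -
        have *: "is_integer (?a (i + j)) \<longleftrightarrow> same_row \<alpha> (i + j)"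
          using that in_row_less[OF r(2)] \<open>i < i'\<close> ab
          by (intro compatible_constant(2)[OF c, of _ "i' + j"]) auto
        have S: "Suc (i + j) < ?n" using in_row_less[OF r(2)] \<open>i < i'\<close> by simp
        \<comment> \<open>If row \<open>i\<close> continued to the right of column \<open>j\<close>,
          then row \<open>Suc i\<close> and all later rows would start beyond column
          \<open>j\<close>, leaving no node at \<open>(i', j)\<close>.\<close>
        have "\<not> same_row \<alpha> (i + j)"
        proof
          assume "same_row \<alpha> (i + j)"
          with in_row_Suc[OF \<alpha> r(1) S] have "in_row \<alpha> i (Suc (i + j))" by simp
          then have "Suc (i + j) < offset \<alpha> (Suc i)" "Suc i \<le> length \<alpha>" by (auto simp: in_row_def)
          then have "j < row_start \<alpha> (Suc i)"
            using offset_row_start[OF \<alpha>, of "Suc i"] by simp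
          also have "\<dots> \<le> row_start \<alpha> i'"
            unfolding row_start_def using \<open>i < i'\<close> by (intro sum_mono2) auto
          also have "\<dots> \<le> j"
            using r(2) offset_row_start[OF \<alpha>, of i'] by (simp add: in_row_def)
          finally show False by simp
        qed
        with * ab show ?thesis by simp
      qed
      ultimately show ?thesis by (cases "a = b") auto
    qed
    show "T \<in> quasi_ribbon_tableaux \<alpha>"
      unfolding quasi_ribbon_tableaux_def
      by (intro CollectI conjI[OF dom conjI] allI impI; elim conjE) (rule row column; assumption)+
  qed
qed

lemma length_reading_word: "composition \<alpha> \<Longrightarrow> length (reading_word \<alpha> T) = sum_list \<alpha>"
  by (simp add: reading_word_eq)

lemma nth_reading_word:
  assumes "composition \<alpha>" "k < sum_list \<alpha>"
  shows "reading_word \<alpha> T ! (reading_order \<alpha> ! k) = entry \<alpha> T k"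
  using assms by (simp add: reading_word_eq reading_order_less reading_order_involution)

lemma standardizes_reading_order_iff:
  assumes "composition \<alpha>"
  shows "standardizes (sum_list \<alpha>) ((!) (reading_order \<alpha>)) w \<longleftrightarrow> length w = sum_list \<alpha> \<and>
    compatible (sum_list \<alpha>) (same_row \<alpha>) (\<lambda>k. w ! (reading_order \<alpha> ! k))"
  using compatible_cong[of "sum_list \<alpha>" _ _ "descent ((!) (reading_order \<alpha>))" "same_row \<alpha>"]
    descent_reading_order[OF assms]
  by (auto simp: standardizes_def bij_betw_reading_order)

text \<open>Rows of the ribbon are the descents of \<open>reading_order\<close>, so the tie
  conditions on tableau and word agree. As the image is closed under the operators, the transported
  operators are well defined.\<close>

lemma bij_betw_reading_word:
  assumes \<alpha>: "composition \<alpha>"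
  shows "bij_betw (reading_word \<alpha>) (quasi_ribbon_tableaux \<alpha>)
    (Collect (standardizes (sum_list \<alpha>) ((!) (reading_order \<alpha>))))"
    (is "bij_betw _ ?Q (Collect ?st)")
proof -
  let ?n = "sum_list \<alpha>" and ?q = "(!) (reading_order \<alpha>)"
  have inj: "inj_on (reading_word \<alpha>) ?Q"
  proof (rule inj_onI)
    fix T U assume TU: "T \<in> ?Q" "U \<in> ?Q" "reading_word \<alpha> T = reading_word \<alpha> U"
    then have "entry \<alpha> T k = entry \<alpha> U k" if "k < ?n" for k
      using nth_reading_word[OF \<alpha> that] by metis
    moreover have "dom T = ribbon \<alpha>" "dom U = ribbon \<alpha>"
      using TU by (simp_all add: quasi_ribbon_tableaux_def)
    ultimately have "T (i, j) = U (i, j)" for i j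
      using filling_entry[OF \<alpha>, of T i j] filling_entry[OF \<alpha>, of U i j] ribbon_iff[OF \<alpha>, of i j]
      by simp
    then show "T = U" by (intro ext) (metis prod.exhaust)
  qed
  have "?st (reading_word \<alpha> T)" if "T \<in> ?Q" for T
  proof -
    have "compatible ?n (same_row \<alpha>) (\<lambda>k. reading_word \<alpha> T ! ?q k)"
      using that compatible_cong[of ?n "\<lambda>k. reading_word \<alpha> T ! ?q k" "entry \<alpha> T" "same_row \<alpha>"]
      by (simp add: quasi_ribbon_tableaux_iff[OF \<alpha>] nth_reading_word[OF \<alpha>])
    then show ?thesis
      by (simp add: standardizes_reading_order_iff[OF \<alpha>] length_reading_word[OF \<alpha>])
  qed
  moreover have "\<exists>T\<in>?Q. reading_word \<alpha> T = w" if w: "?st w" for w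
  proof -
    \<comment> \<open>The sorted letters of \<open>w\<close> are laid out along the ribbon, the
      \<open>k\<close>-th one at node \<open>k\<close>.\<close>
    define T where "T = (\<lambda>(i, j). if (i, j) \<in> ribbon \<alpha> then Some (w ! ?q (i + j)) else None)"
    have dom: "dom T = ribbon \<alpha>" by (auto simp: T_def split: if_splits)
    have entry: "entry \<alpha> T k = w ! ?q k" if "k < ?n" for k
    proof -
      have r: "in_row \<alpha> (row_of \<alpha> k) k" using in_row_row_of[OF that] .
      with in_row_le[OF \<alpha> r] show ?thesis
        by (simp add: entry_def T_def ribbon_iff_in_row[OF \<alpha>])
    qed
    have "compatible ?n (same_row \<alpha>) (entry \<alpha> T)"
      using w compatible_cong[of ?n "entry \<alpha> T" "\<lambda>k. w ! ?q k" "same_row \<alpha>" "same_row \<alpha>"]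
      by (simp add: standardizes_reading_order_iff[OF \<alpha>] entry)
    with dom have "T \<in> ?Q" by (simp add: quasi_ribbon_tableaux_iff[OF \<alpha>])
    moreover have "reading_word \<alpha> T = w"
      by (rule list_eq_via_bij[OF bij_betw_reading_order[OF refl, of \<alpha>]])
        (use w in \<open>simp_all add: standardizes_def nth_reading_word[OF \<alpha>] entry length_reading_word[OF \<alpha>]\<close>)
    ultimately show ?thesis by blast
  qed
  ultimately have "reading_word \<alpha> ` ?Q = Collect ?st" by blast
  with inj show ?thesis by (simp add: bij_betw_def)
qed

section \<open>The crystal of tableaux of a fixed shape\<close>

lemma tableau_crystal_simps [simp]:
  "elems (tableau_crystal \<alpha>) = quasi_ribbon_tableaux \<alpha>"
  "wt (tableau_crystal \<alpha>) T = wt word_crystal (reading_word \<alpha> T)"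
  "eps (tableau_crystal \<alpha>) i T = eps word_crystal i (reading_word \<alpha> T)"
  "phi (tableau_crystal \<alpha>) i T = phi word_crystal i (reading_word \<alpha> T)"
  "e_op (tableau_crystal \<alpha>) i T = map_option (tableau_of_word \<alpha>) (word_op letter_e i (reading_word \<alpha> T))"
  "f_op (tableau_crystal \<alpha>) i T = map_option (tableau_of_word \<alpha>) (word_op letter_f i (reading_word \<alpha> T))"
  by (simp_all add: tableau_crystal_def)

text \<open>\<open>tableau_of_word\<close> is meaningful only on reading words; the assumption on
  \<open>z\<close> guarantees that it is applied to one.\<close>

lemma map_tableau_of_word_Some_iff:
  assumes \<alpha>: "composition \<alpha>"
    and z: "\<And>v. z = Some v \<Longrightarrow> standardizes (sum_list \<alpha>) ((!) (reading_order \<alpha>)) v"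
  shows "map_option (tableau_of_word \<alpha>) z = Some T \<longleftrightarrow>
    T \<in> quasi_ribbon_tableaux \<alpha> \<and> z = Some (reading_word \<alpha> T)"
proof (cases z)
  case (Some v)
  have bij: "bij_betw (reading_word \<alpha>) (quasi_ribbon_tableaux \<alpha>)
      (Collect (standardizes (sum_list \<alpha>) ((!) (reading_order \<alpha>))))"
    using bij_betw_reading_word[OF \<alpha>] .
  then have inj: "inj_on (reading_word \<alpha>) (quasi_ribbon_tableaux \<alpha>)" by (simp add: bij_betw_def)
  obtain U where U: "U \<in> quasi_ribbon_tableaux \<alpha>" "v = reading_word \<alpha> U"
    using z[OF Some] bij by (auto simp: bij_betw_def)
  then have "tableau_of_word \<alpha> v = U"
    unfolding tableau_of_word_def using inj by (simp add: the_inv_into_f_f)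
  with U Some inj show ?thesis by (auto simp: inj_on_eq_iff)
qed simp

lemma tableau_op_iff:
  assumes \<alpha>: "composition \<alpha>" and T: "T \<in> quasi_ribbon_tableaux \<alpha>"
  shows "e_op (tableau_crystal \<alpha>) i T = Some U \<longleftrightarrow>
      U \<in> quasi_ribbon_tableaux \<alpha> \<and> word_op letter_e i (reading_word \<alpha> T) = Some (reading_word \<alpha> U)"
    and "f_op (tableau_crystal \<alpha>) i T = Some U \<longleftrightarrow>
      U \<in> quasi_ribbon_tableaux \<alpha> \<and> word_op letter_f i (reading_word \<alpha> T) = Some (reading_word \<alpha> U)"
proof -
  have st: "standardizes (sum_list \<alpha>) ((!) (reading_order \<alpha>)) (reading_word \<alpha> T)"
    using bij_betw_reading_word[OF \<alpha>] T by (auto simp: bij_betw_def)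
  show "e_op (tableau_crystal \<alpha>) i T = Some U \<longleftrightarrow>
      U \<in> quasi_ribbon_tableaux \<alpha> \<and> word_op letter_e i (reading_word \<alpha> T) = Some (reading_word \<alpha> U)"
    unfolding tableau_crystal_simps
    by (intro map_tableau_of_word_Some_iff[OF \<alpha>] standardizes_e_imp[OF st])
  show "f_op (tableau_crystal \<alpha>) i T = Some U \<longleftrightarrow>
      U \<in> quasi_ribbon_tableaux \<alpha> \<and> word_op letter_f i (reading_word \<alpha> T) = Some (reading_word \<alpha> U)"
    unfolding tableau_crystal_simps
    by (intro map_tableau_of_word_Some_iff[OF \<alpha>] standardizes_f_imp[OF st])
qed

lemma gl_crystal_tableau:
  assumes \<alpha>: "composition \<alpha>"
  shows "gl_crystal (tableau_crystal \<alpha>)"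
proof -
  interpret W: gl_crystal word_crystal by (rule gl_crystal_word)
  note op = tableau_op_iff[OF \<alpha>]
  show ?thesis
  proof (standard, goal_cases)
    case (3 i T)
    show ?case using W.phi_plus_eps[of "reading_word \<alpha> T" i] by simp
  next
    case (4 i T U)
    then have "e_op word_crystal i (reading_word \<alpha> T) = Some (reading_word \<alpha> U)" by (simp add: op del: tableau_crystal_simps(5))
    from W.e_step[OF _ this] show ?case by (simp del: word_crystal_simps(4,5))
  next
    case (5 i T U)
    then have "f_op word_crystal i (reading_word \<alpha> T) = Some (reading_word \<alpha> U)" by (simp add: op del: tableau_crystal_simps(6))
    from W.f_step[OF _ this] show ?case by (simp del: word_crystal_simps(4,5))
  qed (simp_all add: op word_f_iff_e del: tableau_crystal_simps(5,6))
qed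

lemma crystal_iso_reading_word:
  assumes \<alpha>: "composition \<alpha>"
  shows "crystal_iso (tableau_crystal \<alpha>) (words_with (sum_list \<alpha>) ((!) (reading_order \<alpha>)))
    (reading_word \<alpha>)"
  using bij_betw_reading_word[OF \<alpha>] tableau_op_iff(2)[OF \<alpha>]
  by (simp add: crystal_iso_def words_with_def del: tableau_crystal_simps(6))

section \<open>Existence and uniqueness of the tableau\<close>

text \<open>Composing with \<open>reading_word\<close> turns the hypothesis into an isomorphism
  between two components of words. The weight then yields size and entries, and
  \<open>descent_eq_of_crystal_iso\<close> the row breaks, all in terms of \<open>w\<close> and
  \<open>p\<close>.\<close>

lemma standardizes_descent_eq_of_gl_equivalent:
  assumes eq: "gl_equivalent word_crystal w (tableau_crystal \<alpha>) T"
    and \<alpha>: "composition \<alpha>" and p: "standardizes n p w"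
  shows "sum_list \<alpha> = n" and "k < n \<Longrightarrow> entry \<alpha> T k = w ! p k"
    and "Suc k < n \<Longrightarrow> same_row \<alpha> k \<longleftrightarrow> descent p k"
proof -
  let ?q = "(!) (reading_order \<alpha>)" and ?u = "reading_word \<alpha> T"
  have T: "T \<in> quasi_ribbon_tableaux \<alpha>" using eq by (simp add: gl_equivalent_def)
  obtain \<psi> where \<psi>: "crystal_iso (component word_crystal w) (component (tableau_crystal \<alpha>) T) \<psi>" "\<psi> w = T"
    using eq by (auto simp: gl_equivalent_def)
  have q: "standardizes (sum_list \<alpha>) ?q ?u"
    using bij_betw_reading_word[OF \<alpha>] T by (auto simp: bij_betw_def)
  have "crystal_iso (tableau_crystal \<alpha>\<lparr>elems := elems (tableau_crystal \<alpha>)\<rparr>)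
      (word_crystal\<lparr>elems := Collect (standardizes (sum_list \<alpha>) ?q)\<rparr>) (reading_word \<alpha>)"
    using crystal_iso_reading_word[OF \<alpha>] by (simp only: words_with_def elems_update_id)
  then have "crystal_iso (component (tableau_crystal \<alpha>) T) (component word_crystal ?u) (reading_word \<alpha>)"
    using T by (intro crystal_iso_component[OF gl_crystal_tableau[OF \<alpha>]
        closed_subset_elems[OF gl_crystal_tableau[OF \<alpha>]] gl_crystal_word closed_subset_standardizes])
      simp_all
  from crystal_iso_comp[OF \<psi>(1) this]
  have iso: "crystal_iso (component word_crystal w) (component word_crystal ?u) (reading_word \<alpha> \<circ> \<psi>)" .
  have w: "w \<in> elems (component word_crystal w)" by simp
  then have "wt word_crystal ((reading_word \<alpha> \<circ> \<psi>) w) = wt word_crystal w"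
    using iso unfolding crystal_iso_def component_simps(2) by blast
  then have m: "mset ?u = mset w" using \<psi>(2) by (simp add: wt_word_eq_iff)
  show n: "sum_list \<alpha> = n" using sequence_eq_of_mset_eq(1)[OF q p m] .
  show "entry \<alpha> T k = w ! p k" if "k < n"
    using sequence_eq_of_mset_eq(2)[OF q p m that] nth_reading_word[OF \<alpha>, of k T] n that by simp
  show "same_row \<alpha> k \<longleftrightarrow> descent p k" if "Suc k < n"
    using descent_eq_of_crystal_iso[OF iso w p _ that, of ?q] q n \<psi>(2) that descent_reading_order[OF \<alpha>]
    by simp
qed

theorem corollary3p5:
  fixes w :: "half_pos list"
  assumes "w \<in> elems word_crystal"
  shows "\<exists>!T. \<exists>\<alpha>. composition \<alpha> \<and> T \<in> quasi_ribbon_tableaux \<alpha> \<and>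
           gl_equivalent word_crystal w (tableau_crystal \<alpha>) T"
proof (rule ex_ex1I)
  define n where "n = length w"
  obtain p where p: "standardizes n p w" using ex_standardizes n_def by blast
  \<comment> \<open>The shape is dictated by \<open>w\<close>: a row continues exactly at the
    descents of \<open>p\<close>.\<close>
  obtain \<alpha> where \<alpha>: "composition \<alpha>" "sum_list \<alpha> = n" "\<And>k. Suc k < n \<Longrightarrow> same_row \<alpha> k = descent p k"
    using ex_composition[of n "descent p"] by blast
  let ?q = "(!) (reading_order \<alpha>)"
  have "crystal_iso (words_with n p) (words_with n ?q) (rearrange n p ?q)"
    using \<alpha> by (intro crystal_iso_rearrange standardizes_bij[OF p] bij_betw_reading_order)
      (simp_all add: descent_reading_order)
  from crystal_iso_comp[OF this crystal_iso_inv[OF crystal_iso_reading_word[OF \<alpha>(1), unfolded \<alpha>(2)]]]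
  obtain \<psi> where \<psi>: "crystal_iso (words_with n p) (tableau_crystal \<alpha>) \<psi>" by blast
  then have iso: "crystal_iso (word_crystal\<lparr>elems := Collect (standardizes n p)\<rparr>)
      (tableau_crystal \<alpha>\<lparr>elems := elems (tableau_crystal \<alpha>)\<rparr>) \<psi>"
    by (simp only: words_with_def elems_update_id)
  have "crystal_iso (component word_crystal w) (component (tableau_crystal \<alpha>) (\<psi> w)) \<psi>"
    using p by (intro crystal_iso_component[OF gl_crystal_word closed_subset_standardizes
        gl_crystal_tableau[OF \<alpha>(1)] closed_subset_elems[OF gl_crystal_tableau[OF \<alpha>(1)]] iso]) simp
  moreover have "\<psi> w \<in> quasi_ribbon_tableaux \<alpha>"
    using \<psi> p by (auto simp: crystal_iso_def words_with_def bij_betw_def)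
  ultimately have "gl_equivalent word_crystal w (tableau_crystal \<alpha>) (\<psi> w)"
    using gl_crystal_word gl_crystal_tableau[OF \<alpha>(1)] by (auto simp: gl_equivalent_def)
  with \<alpha>(1) \<open>\<psi> w \<in> quasi_ribbon_tableaux \<alpha>\<close>
  show "\<exists>T \<alpha>. composition \<alpha> \<and> T \<in> quasi_ribbon_tableaux \<alpha> \<and>
      gl_equivalent word_crystal w (tableau_crystal \<alpha>) T" by blast
next
  fix T U
  assume "\<exists>\<alpha>. composition \<alpha> \<and> T \<in> quasi_ribbon_tableaux \<alpha> \<and>
      gl_equivalent word_crystal w (tableau_crystal \<alpha>) T"
    and "\<exists>\<alpha>. composition \<alpha> \<and> U \<in> quasi_ribbon_tableaux \<alpha> \<and>
      gl_equivalent word_crystal w (tableau_crystal \<alpha>) U"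
  then obtain \<alpha> \<beta> where \<alpha>: "composition \<alpha>" "T \<in> quasi_ribbon_tableaux \<alpha>"
      "gl_equivalent word_crystal w (tableau_crystal \<alpha>) T"
    and \<beta>: "composition \<beta>" "U \<in> quasi_ribbon_tableaux \<beta>"
      "gl_equivalent word_crystal w (tableau_crystal \<beta>) U" by blast
  \<comment> \<open>The same \<open>p\<close> is used for both tableaux, so their entries and row
    breaks are expressed by the same data even though the shapes may differ a priori.\<close>
  obtain p where p: "standardizes (length w) p w" using ex_standardizes by blast
  note T = standardizes_descent_eq_of_gl_equivalent[OF \<alpha>(3,1) p]
    and U = standardizes_descent_eq_of_gl_equivalent[OF \<beta>(3,1) p]
  have row: "row_of \<alpha> k = row_of \<beta> k" if "k < length w" for k
    using row_of_cong[OF \<alpha>(1) \<beta>(1) T(1) U(1)] T(3) U(3) that by blast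
  have ribbon: "(i, j) \<in> ribbon \<alpha> \<longleftrightarrow> (i, j) \<in> ribbon \<beta>" for i j
    using row T(1) U(1) by (auto simp: ribbon_iff \<alpha>(1) \<beta>(1))
  have "T (i, j) = U (i, j)" for i j
  proof -
    have "dom T = ribbon \<alpha>" "dom U = ribbon \<beta>"
      using \<alpha>(2) \<beta>(2) by (simp_all add: quasi_ribbon_tableaux_def)
    from filling_entry[OF \<alpha>(1) this(1), of i j] filling_entry[OF \<beta>(1) this(2), of i j]
    show ?thesis
      using ribbon[of i j] ribbon_iff[OF \<alpha>(1), of i j] T(1) T(2)[of "i + j"] U(2)[of "i + j"]
      by (cases "(i, j) \<in> ribbon \<beta>") simp_all
  qed
  then show "T = U" by (intro ext) (metis prod.exhaust)
qed

end
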